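(* Let $X$ be a closed subscheme of $\mathbb{P}^n$. If there are integers $d,\ell,r$, where $1\leq\ell\leq d$ and $r\geq 1$, for which $$H_X(d)=\binom{r+d}{d}+\cdots+\binom{r+(d-\ell+1)}{d-\ell+1}\quad\text{and}\quad \Delta H_X(d)=H_X(d)_{\langle d\rangle},$$ then $(I_X)_d=(I_{F_\Lambda})_d$, where $F_\Lambda$ is a hypersurface of degree $\ell$ in some $(r+1)$-dimensional linear subspace $\Lambda$ of $\mathbb{P}^n$. In other words, there exist linear forms $L_1,\dots,L_{n-(r+1)}$ and a homogeneous form $F$ of degree $\ell$ such that $$(I_X)_d=\big(L_1,\dots,L_{n-(r+1)},F\big)_d.$$
   Context: $k$ is an algebraically closed field of characteristic $0$, $R=k[x_0,\dots,x_n]$, $\mathbb{P}^n=\operatorname{Proj}R$. For a closed subscheme $X\subset\mathbb{P}^n$, $I_X\subset R$ is its saturated homogeneous ideal, $H_X(d)=\dim_k(R/I_X)_d$ is its Hilbert function, and $\Delta H_X(d)=H_X(d)-H_X(d-1)$. A subscript $d$ on a homogeneous ideal denotes its degree-$d$ component. For integers $c,d>0$ the $d$-binomial expansion of $c$ is the unique expression $c=\binom{k_d}{d}+\binom{k_{d-1}}{d-1}+\cdots+\binom{k_\delta}{\delta}$ with $k_d>k_{d-1}>\cdots>k_\delta\geq\delta>0$, and $c_{\langle d\rangle}=\binom{k_d-1}{d}+\cdots+\binom{k_\delta-1}{\delta}$ (with $\binom ij=0$ if $i<j$). A hypersurface of degree $\ell$ in a linear subspace $\Lambda$ is the closed subscheme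 with ideal $I_\Lambda+(F)$, where $F$ is a form of degree $\ell$ not in $I_\Lambda$.
   Formalization: The hypothesis r+1 ≤ n is added; it excludes only r = n, ℓ = 1, (I_X)_d = 0 (for example X = P^n), where the numerical conditions hold but P^n has no (n+1)-dimensional linear subspace. *)

theory Defs
  imports
    "HOL-Algebra.Algebra"
    "HOL-Library.Poly_Mapping"
    "HOL-Computational_Algebra.Polynomial"
begin

section \<open>The polynomial ring and its forms\<close>

text \<open>Monomials are exponent vectors \<^typ>\<open>nat \<Rightarrow>\<^sub>0 nat\<close>; a polynomial maps monomials to
  coefficients, with the ring operations of \<^typ>\<open>('b::comm_monoid_add) \<Rightarrow>\<^sub>0 ('c::comm_ring_1)\<close>
  (convolution product).\<close>

type_synonym 'k mpoly = "(nat \<Rightarrow>\<^sub>0 nat) \<Rightarrow>\<^sub>0 'k"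

definition var_poly :: "nat \<Rightarrow> 'k::field mpoly"
  where "var_poly i = Poly_Mapping.single (Poly_Mapping.single i 1) 1"

definition Const :: "'k::field \<Rightarrow> 'k mpoly"
  where "Const a = Poly_Mapping.single 0 a"

definition mono_degree :: "(nat \<Rightarrow>\<^sub>0 nat) \<Rightarrow> nat"
  where "mono_degree m = (\<Sum>i\<in>Poly_Mapping.keys m. Poly_Mapping.lookup m i)"

text \<open>The ring \<open>k[x\<^sub>0, \<dots>, x\<^sub>n]\<close>, in \<open>n + 1\<close> variables.\<close>

definition coord_ring :: "nat \<Rightarrow> 'k::field mpoly ring"
  where "coord_ring n =
    \<lparr> carrier = {p. \<forall>m\<in>Poly_Mapping.keys p. Poly_Mapping.keys m \<subseteq> {..n}},
      monoid.mult = (*), monoid.one = 1, ring.zero = 0, ring.add = (+) \<rparr>"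

text \<open>The degree-\<open>d\<close> component of \<^term>\<open>coord_ring n\<close>; it contains \<open>0\<close>.\<close>

definition forms :: "nat \<Rightarrow> nat \<Rightarrow> 'k::field mpoly set"
  where "forms n d =
    {p \<in> carrier (coord_ring n). \<forall>m\<in>Poly_Mapping.keys p. mono_degree m = d}"

lemma coord_ring_cring: "cring (coord_ring n :: 'k::field mpoly ring)"
proof -
  let ?C = "{p :: 'k mpoly. \<forall>m\<in>Poly_Mapping.keys p. Poly_Mapping.keys m \<subseteq> {..n}}"
  have add: "p + q \<in> ?C" if "p \<in> ?C" "q \<in> ?C" for p q
    using that Poly_Mapping.keys_add[of p q] by blast
  have mult: "p * q \<in> ?C" if pq: "p \<in> ?C" "q \<in> ?C" for p q
  proof -
    have "Poly_Mapping.keys m \<subseteq> {..n}" if m: "m \<in> Poly_Mapping.keys (p * q)" for m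
    proof -
      obtain a b where "m = a + b" "a \<in> Poly_Mapping.keys p" "b \<in> Poly_Mapping.keys q"
        using m keys_mult[of p q] by blast
      then show ?thesis using pq Poly_Mapping.keys_add[of a b] by blast
    qed
    then show ?thesis by blast
  qed
  have one: "1 \<in> ?C" by simp
  have neg: "- p \<in> ?C" if "p \<in> ?C" for p
    using that by simp
  have sel: "carrier (coord_ring n) = ?C"
    "\<And>p q. p \<oplus>\<^bsub>coord_ring n\<^esub> q = p + q" "\<And>p q. p \<otimes>\<^bsub>coord_ring n\<^esub> q = p * q"
    "\<zero>\<^bsub>coord_ring n\<^esub> = 0" "\<one>\<^bsub>coord_ring n\<^esub> = 1"
    unfolding coord_ring_def by simp_all
  show ?thesis
  proof (rule cringI)
    show "abelian_group (coord_ring n :: 'k mpoly ring)"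
    proof (rule abelian_groupI, unfold sel)
      show "\<exists>q\<in>?C. q + p = 0" if "p \<in> ?C" for p
        using neg[OF that] by (rule bexI[rotated]) simp
    qed (use add in \<open>simp_all only: ac_simps add_0_left add_0_right\<close>, simp)
    show "comm_monoid (coord_ring n :: 'k mpoly ring)"
      by (rule comm_monoidI, unfold sel) (use mult one in \<open>simp_all only: ac_simps mult_1_left mult_1_right\<close>)
    show "(p \<oplus>\<^bsub>coord_ring n\<^esub> q) \<otimes>\<^bsub>coord_ring n\<^esub> u =
        p \<otimes>\<^bsub>coord_ring n\<^esub> u \<oplus>\<^bsub>coord_ring n\<^esub> q \<otimes>\<^bsub>coord_ring n\<^esub> u" for p q u :: "'k mpoly"
      unfolding sel by (rule distrib_right)
  qed
qed


section \<open>Closed subschemes of projective space\<close>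

text \<open>A closed subscheme of \<open>\<P>\<^sup>n\<close> is represented by its saturated homogeneous ideal.  The
  unit ideal is allowed; it is the ideal of the empty subscheme.\<close>

definition homogeneous_ideal :: "nat \<Rightarrow> 'k::field mpoly set \<Rightarrow> bool"
  where "homogeneous_ideal n I \<longleftrightarrow>
    (\<exists>S. S \<subseteq> (\<Union>d. forms n d) \<and> I = genideal (coord_ring n) S)"

definition saturated :: "nat \<Rightarrow> 'k::field mpoly set \<Rightarrow> bool"
  where "saturated n I \<longleftrightarrow>
    (\<forall>f\<in>carrier (coord_ring n). (\<forall>i\<le>n. \<exists>N. var_poly i ^ N * f \<in> I) \<longrightarrow> f \<in> I)"

definition subscheme_ideal :: "nat \<Rightarrow> 'k::field mpoly set \<Rightarrow> bool"
  where "subscheme_ideal n I \<longleftrightarrow> homogeneous_ideal n I \<and> saturated n I"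

definition component :: "nat \<Rightarrow> 'k::field mpoly set \<Rightarrow> nat \<Rightarrow> 'k mpoly set"
  where "component n I d = I \<inter> forms n d"

text \<open>\<open>dim\<^sub>k (R/I)\<^sub>d\<close>: the graded piece is the image of \<open>R\<^sub>d\<close> in the quotient ring, and the
  scalars are the classes of the constant polynomials.\<close>

definition hilbert_function :: "nat \<Rightarrow> 'k::field mpoly set \<Rightarrow> nat \<Rightarrow> nat"
  where "hilbert_function n I d =
    (ring.dim (coord_ring n Quot I) over (range (\<lambda>a. I +>\<^bsub>coord_ring n\<^esub> Const a)))
      ((\<lambda>f. I +>\<^bsub>coord_ring n\<^esub> f) ` forms n d)"

text \<open>Used for \<open>d \<ge> 1\<close> only.\<close>

definition hilbert_diff :: "nat \<Rightarrow> 'k::field mpoly set \<Rightarrow> nat \<Rightarrow> int"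
  where "hilbert_diff n I d = int (hilbert_function n I d) - int (hilbert_function n I (d - 1))"

text \<open>An \<open>s\<close>-dimensional linear subspace of \<open>\<P>\<^sup>n\<close> is cut out by \<open>n - s\<close> linear forms that are
  linearly independent over \<open>k\<close>.\<close>

definition linear_subspace_ideal :: "nat \<Rightarrow> nat \<Rightarrow> 'k::field mpoly set \<Rightarrow> bool"
  where "linear_subspace_ideal n s J \<longleftrightarrow> s \<le> n \<and>
    (\<exists>Ls. length Ls = n - s \<and> set Ls \<subseteq> forms n 1 \<and>
      ring.independent (coord_ring n) (range Const) Ls \<and> J = genideal (coord_ring n) (set Ls))"

text \<open>\<^term>\<open>H\<close> is the ideal of a hypersurface of degree \<^term>\<open>l\<close> in the linear subspace with
  ideal \<^term>\<open>J\<close>.\<close>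

definition hypersurface_ideal :: "nat \<Rightarrow> 'k::field mpoly set \<Rightarrow> nat \<Rightarrow> 'k mpoly set \<Rightarrow> bool"
  where "hypersurface_ideal n J l H \<longleftrightarrow>
    (\<exists>F\<in>forms n l. F \<notin> J \<and> H = J <+>\<^bsub>coord_ring n\<^esub> PIdl\<^bsub>coord_ring n\<^esub> F)"


section \<open>Binomial expansions\<close>

definition binomial_expansion :: "nat \<Rightarrow> nat \<Rightarrow> nat \<Rightarrow> (nat \<Rightarrow> nat) \<Rightarrow> bool"
  where "binomial_expansion c d \<delta> k \<longleftrightarrow>
    0 < \<delta> \<and> \<delta> \<le> d \<and> \<delta> \<le> k \<delta> \<and> (\<forall>i. \<delta> \<le> i \<and> i < d \<longrightarrow> k i < k (Suc i)) \<and>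
    c = (\<Sum>i=\<delta>..d. k i choose i)"

text \<open>\<open>c\<^sub>\<langle>\<^sub>d\<^sub>\<rangle>\<close>, meaningful for \<open>c, d > 0\<close> by the existence and uniqueness lemmas below.\<close>

definition binomial_lower :: "nat \<Rightarrow> nat \<Rightarrow> nat"
  where "binomial_lower c d =
    (THE v. \<exists>\<delta> k. binomial_expansion c d \<delta> k \<and> v = (\<Sum>i=\<delta>..d. (k i - 1) choose i))"

lemma binomial_expansion_top_ge:
  assumes "binomial_expansion c d \<delta> k" shows "d \<le> k d"
proof -
  have "\<delta> \<le> d" using assms by (simp add: binomial_expansion_def)
  moreover have "\<delta> \<le> e \<Longrightarrow> e \<le> d \<Longrightarrow> e \<le> k e" for e
  proof (induction e)
    case (Suc e)
    show ?case
    proof (cases "\<delta> = Suc e")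
      case True then show ?thesis using assms by (simp add: binomial_expansion_def)
    next
      case False
      then have "e \<le> k e" "k e < k (Suc e)"
        using Suc assms by (auto simp: binomial_expansion_def)
      then show ?thesis by simp
    qed
  qed simp
  ultimately show ?thesis by simp
qed

lemma binomial_expansion_Suc:
  assumes "binomial_expansion c (Suc d) \<delta> k" "\<delta> \<noteq> Suc d"
  shows "binomial_expansion (c - (k (Suc d) choose Suc d)) d \<delta> k"
    and "c = (k (Suc d) choose Suc d) + (c - (k (Suc d) choose Suc d))"
    and "k d < k (Suc d)"
  using assms by (auto simp: binomial_expansion_def)

lemma binomial_expansion_bounds:
  assumes "binomial_expansion c d \<delta> k"
  shows "(k d choose d) \<le> c" and "c < Suc (k d) choose d"
proof -
  show "(k d choose d) \<le> c"
  proof -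
    have "d \<in> {\<delta>..d}" "c = (\<Sum>i=\<delta>..d. k i choose i)"
      using assms by (auto simp: binomial_expansion_def)
    then show ?thesis using member_le_sum[of d "{\<delta>..d}" "\<lambda>i. k i choose i"] by blast
  qed
  show "c < Suc (k d) choose d"
    using assms
  proof (induction d arbitrary: c)
    case 0 then show ?case by (auto simp: binomial_expansion_def)
  next
    case (Suc d)
    show ?case
    proof (cases "\<delta> = Suc d")
      case True
      moreover have "d \<le> k (Suc d)" using binomial_expansion_top_ge[OF Suc.prems] by simp
      ultimately show ?thesis using Suc.prems by (simp add: binomial_expansion_def)
    next
      case False
      note s = binomial_expansion_Suc[OF Suc.prems False]
      have "(Suc (k d) choose d) \<le> (k (Suc d) choose d)"
        using s(3) by (intro binomial_right_mono) auto
      then show ?thesis using Suc.IH[OF s(1)] s(2) by simp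
    qed
  qed
qed

lemma binomial_expansion_unique:
  assumes "binomial_expansion c d \<delta> k" "binomial_expansion c d \<delta>' k'"
  shows "\<delta> = \<delta>' \<and> (\<forall>i\<in>{\<delta>..d}. k i = k' i)"
  using assms
proof (induction d arbitrary: c)
  case 0 then show ?case by (auto simp: binomial_expansion_def)
next
  case (Suc d)
  have le: "k1 (Suc d) \<le> k2 (Suc d)"
    if "binomial_expansion c (Suc d) d1 k1" "binomial_expansion c (Suc d) d2 k2" for d1 d2 k1 k2
  proof (rule ccontr)
    assume "\<not> ?thesis"
    then have "(Suc (k2 (Suc d)) choose Suc d) \<le> (k1 (Suc d) choose Suc d)"
      by (intro binomial_right_mono) auto
    then show False
      using binomial_expansion_bounds(1)[OF that(1)] binomial_expansion_bounds(2)[OF that(2)]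
      by linarith
  qed
  have top: "k (Suc d) = k' (Suc d)"
    using le[OF Suc.prems] le[OF Suc.prems(2,1)] by simp
  have pos: "0 < c'" if "binomial_expansion c' d d1 k1" for c' d1 k1
  proof -
    have "0 < (k1 d choose d)" using binomial_expansion_top_ge[OF that] by simp
    then show ?thesis using binomial_expansion_bounds(1)[OF that] by linarith
  qed
  have end_iff: "d1 = Suc d \<longleftrightarrow> c = (k1 (Suc d) choose Suc d)"
    if "binomial_expansion c (Suc d) d1 k1" for d1 k1
  proof
    assume "d1 = Suc d"
    then show "c = (k1 (Suc d) choose Suc d)" using that by (simp add: binomial_expansion_def)
  next
    assume c: "c = (k1 (Suc d) choose Suc d)"
    show "d1 = Suc d"
    proof (rule ccontr)
      assume "d1 \<noteq> Suc d"
      then show False using pos[OF binomial_expansion_Suc(1)[OF that]] c by simp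
    qed
  qed
  show ?case
  proof (cases "\<delta> = Suc d")
    case True
    then have "\<delta>' = Suc d" using end_iff[OF Suc.prems(1)] end_iff[OF Suc.prems(2)] top by simp
    then show ?thesis using True top by simp
  next
    case False
    then have F': "\<delta>' \<noteq> Suc d" using end_iff[OF Suc.prems(1)] end_iff[OF Suc.prems(2)] top by simp
    have "\<delta> = \<delta>' \<and> (\<forall>i\<in>{\<delta>..d}. k i = k' i)"
      using Suc.IH binomial_expansion_Suc(1)[OF Suc.prems(1) False]
        binomial_expansion_Suc(1)[OF Suc.prems(2) F'] top by simp
    then show ?thesis using top by (auto simp: le_Suc_eq)
  qed
qed

lemma binomial_expansion_exists:
  assumes "0 < c" "0 < d" shows "\<exists>\<delta> k. binomial_expansion c d \<delta> k"
  using assms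
proof (induction d arbitrary: c)
  case (Suc d)
  show ?case
  proof (cases "d = 0")
    case True
    then have "binomial_expansion c (Suc d) 1 (\<lambda>_. c)"
      using Suc.prems by (simp add: binomial_expansion_def)
    then show ?thesis by blast
  next
    case False
    define P where "P j \<longleftrightarrow> (j choose Suc d) \<le> c" for j
    have bound: "j \<le> c + Suc d" if "P j" for j
    proof (rule ccontr)
      assume "\<not> ?thesis"
      then have j: "c + Suc d < j" by simp
      have "Suc t \<le> (t + Suc d) choose Suc d" for t
      proof (induction t)
        case (Suc t)
        have "0 < ((t + Suc d) choose d)" by (rule zero_less_binomial) simp
        moreover have "(Suc t + Suc d) choose Suc d = ((t + Suc d) choose d) + ((t + Suc d) choose Suc d)"
          by (simp only: add_Suc binomial_Suc_Suc)
        ultimately show ?case using Suc by linarith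
      qed simp
      from this[of c] have "c < (c + Suc d) choose Suc d" by simp
      also have "\<dots> \<le> j choose Suc d" using j by (intro binomial_right_mono) auto
      finally show False using that by (simp add: P_def)
    qed
    have Pd: "P (Suc d)" using Suc.prems by (simp add: P_def)
    define m where "m = Greatest P"
    have Pm: "P m" unfolding m_def by (rule GreatestI_nat[of P, OF Pd bound])
    have mge: "Suc d \<le> m" unfolding m_def by (rule Greatest_le_nat[of P, OF Pd bound])
    have nP: "\<not> P (Suc m)" 
      using Greatest_le_nat[of P "Suc m" "c + Suc d"] bound unfolding m_def by force
    show ?thesis
    proof (cases "c = (m choose Suc d)")
      case True
      then have "binomial_expansion c (Suc d) (Suc d) (\<lambda>_. m)"
        using mge by (simp add: binomial_expansion_def)
      then show ?thesis by blast
    next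
      case c: False
      define c' where "c' = c - (m choose Suc d)"
      have cc: "c = (m choose Suc d) + c'" "0 < c'" using Pm c by (auto simp: P_def c'_def)
      obtain \<delta> k where e: "binomial_expansion c' d \<delta> k" using Suc.IH cc(2) False by blast
      have "c' < (m choose d)" using nP cc by (simp add: P_def)
      then have "(k d choose d) < (m choose d)"
        using binomial_expansion_bounds(1)[OF e] by simp
      then have km: "k d < m" by (metis binomial_right_mono leD not_less)
      have "binomial_expansion c (Suc d) \<delta> (k(Suc d := m))"
        using e km cc(1) by (auto simp: binomial_expansion_def less_Suc_eq)
      then show ?thesis by blast
    qed
  qed
qed simp

end

theory Submission
  imports Defs
begin

text \<open>
  Let \<open>h\<^sub>r(s) = \<Sum>\<^sub>j (r+j-1 choose j)\<close>, \<open>s-l < j \<le> s\<close>, be the Hilbert function of a hypersurface of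
  degree \<open>l\<close> in \<open>\<P>\<^sup>r\<close>; the hypotheses say \<open>H\<^sub>X(d) = h\<^sub>r\<^sub>+\<^sub>1(d)\<close> and \<open>\<Delta>H\<^sub>X(d) = h\<^sub>r(d)\<close>.  As \<open>I\<close> is
  saturated and \<open>k\<close> is infinite, some linear form \<open>L\<close> is not a zero divisor on \<open>R/I\<close> in degrees
  below \<open>d\<close>, so \<open>\<Delta>H\<^sub>X\<close> is the Hilbert function of \<open>R/(I,L)\<close> up to degree \<open>d\<close>.  Macaulay's growth
  bound, read downwards from degree \<open>d\<close>, gives \<open>\<Delta>H\<^sub>X(s) \<ge> h\<^sub>r(s)\<close> for \<open>1 \<le> s \<le> d\<close>, and summing
  from \<open>d\<close> down gives \<open>H\<^sub>X(s) \<le> h\<^sub>r\<^sub>+\<^sub>1(s)\<close>.  For \<open>s = 1\<close> this yields \<open>n-(r+1)\<close> independent linear forms in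
  \<open>I\<close>, and for \<open>s = l\<close> a form \<open>F \<in> I\<close> of degree \<open>l\<close> in the remaining \<open>r+2\<close> variables.  The ideal they
  generate lies in \<open>I\<close> and has the same dimension in degree \<open>d\<close>.

  Macaulay's bound is needed for the single expansion \<open>h\<^sub>r(s)\<close> only.  Passing to standard monomials
  turns it into a statement on shadows of sets of monomials; two-variable compressions reduce that to
  strongly stable sets, where the shadow is the quotient by the first variable.
\<close>

section \<open>Strongly stable sets of monomials\<close>

abbreviation xm :: "nat \<Rightarrow> nat \<Rightarrow>\<^sub>0 nat"
  where "xm i \<equiv> Poly_Mapping.single i 1"

section \<open>Weighted degrees of monomials\<close>

definition weight :: "(nat \<Rightarrow> nat) \<Rightarrow> (nat \<Rightarrow>\<^sub>0 nat) \<Rightarrow> nat"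
  where "weight w m = (\<Sum>i\<in>Poly_Mapping.keys m. w i * Poly_Mapping.lookup m i)"

lemma weight_superset:
  assumes "finite A" "Poly_Mapping.keys m \<subseteq> A"
  shows "weight w m = (\<Sum>i\<in>A. w i * Poly_Mapping.lookup m i)"
  unfolding weight_def using assms by (intro sum.mono_neutral_left) (auto simp: in_keys_iff)

lemma weight_add: "weight w (a + b) = weight w a + weight w b"
proof -
  let ?A = "Poly_Mapping.keys a \<union> Poly_Mapping.keys b"
  have "weight w (a + b) = (\<Sum>i\<in>?A. w i * Poly_Mapping.lookup (a + b) i)"
    by (rule weight_superset) (auto dest: subsetD[OF Poly_Mapping.keys_add])
  also have "\<dots> = weight w a + weight w b"
    by (simp add: weight_superset[of ?A] lookup_add algebra_simps sum.distrib)
  finally show ?thesis .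
qed

lemma weight_single: "weight w (Poly_Mapping.single i a) = w i * a"
  by (simp add: weight_def)

lemma mono_degree_weight: "mono_degree = weight (\<lambda>_. 1)"
  by (simp add: fun_eq_iff mono_degree_def weight_def)

lemma mono_degree_add: "mono_degree (a + b) = mono_degree a + mono_degree b"
  by (simp add: mono_degree_weight weight_add)

lemma mono_degree_single: "mono_degree (Poly_Mapping.single i a) = a"
  by (simp add: mono_degree_weight weight_single)

lemma mono_degree_eq_0_iff: "mono_degree m = 0 \<longleftrightarrow> m = 0"
  by (auto simp: mono_degree_def in_keys_iff intro!: poly_mapping_eqI)

lemma split_xm:
  assumes "Poly_Mapping.lookup m i \<noteq> 0"
  obtains u where "m = u + xm i"
proof
  show "m = (m - xm i) + xm i"
    using assms by (intro poly_mapping_eqI) (auto simp: lookup_add lookup_minus lookup_single when_def)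
qed

lemma keys_add_monomial:
  "Poly_Mapping.keys (a + b) = Poly_Mapping.keys a \<union> Poly_Mapping.keys (b :: nat \<Rightarrow>\<^sub>0 nat)"
  by (auto simp: in_keys_iff lookup_add)

section \<open>Hilbert functions of hypersurfaces in projective space\<close>

definition hyp_hf :: "nat \<Rightarrow> nat \<Rightarrow> nat \<Rightarrow> nat"
  where "hyp_hf r s l = (\<Sum>j=Suc s - l..s. (r + j - 1) choose j)"

text \<open>Numerical form of cutting with a general hyperplane: after an index shift by one,
  Pascal's rule holds term by term. If the range starts at \<open>0\<close>, the terms of index
  \<open>0\<close> on the left and in the first summand match.\<close>

lemma hyp_hf_pascal: "hyp_hf (Suc r) (Suc s) l = hyp_hf r (Suc s) l + hyp_hf (Suc r) s l"
proof (cases "l \<le> Suc s")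
  case True
  then have e: "Suc (Suc s) - l = Suc (Suc s - l)" by simp
  show ?thesis
    unfolding hyp_hf_def e sum.shift_bounds_cl_Suc_ivl sum.distrib[symmetric]
    by (rule sum.cong) simp_all
next
  case False
  then have e: "Suc (Suc s) - l = 0" "Suc s - l = 0" by simp_all
  show ?thesis
    unfolding hyp_hf_def e sum.atLeast0_atMost_Suc_shift
    by (simp add: sum.distrib)
qed

lemma hyp_hf_0: "l \<le> s \<Longrightarrow> hyp_hf 0 s l = 0"
  unfolding hyp_hf_def by (auto intro!: sum.neutral)

lemma hyp_hf_mono: "l \<le> l' \<Longrightarrow> hyp_hf r s l \<le> hyp_hf r s l'"
  unfolding hyp_hf_def by (rule sum_mono2) auto

text \<open>The subtraction is truncated, so for \<open>l > s\<close> the sum starts at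
  \<open>0\<close>: a form of degree \<open>l\<close> imposes no condition in lower degrees.\<close>

lemma hyp_hf_truncate: "s < l \<Longrightarrow> hyp_hf r s l = hyp_hf r s (Suc s)"
  unfolding hyp_hf_def by simp

lemma hyp_hf_Suc: "hyp_hf r s (Suc s) = Suc (hyp_hf r s s)"
proof -
  have "{0..s} = insert 0 {Suc 0..s}" by auto
  then show ?thesis unfolding hyp_hf_def by simp
qed

lemma hyp_hf_full: "hyp_hf (Suc r) s (Suc s) = (Suc r + s) choose s"
  unfolding hyp_hf_def using sum_choose_lower[of r s] by (simp add: atLeast0AtMost)

text \<open>The sets model standard monomials, not the monomials of an ideal, so the closure goes
  towards smaller indices. The offset \<open>k\<close> lets variables be eliminated one at a time
  without renumbering.\<close>

definition strongly_stable :: "nat \<Rightarrow> nat \<Rightarrow> (nat \<Rightarrow>\<^sub>0 nat) set \<Rightarrow> bool"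
  where "strongly_stable k s A \<longleftrightarrow> finite A \<and>
    (\<forall>m\<in>A. mono_degree m = s \<and> (\<forall>i<k. Poly_Mapping.lookup m i = 0)) \<and>
    (\<forall>u i j. k \<le> i \<and> i < j \<and> u + xm j \<in> A \<longrightarrow> u + xm i \<in> A)"

definition mono_quot :: "nat \<Rightarrow> (nat \<Rightarrow>\<^sub>0 nat) set \<Rightarrow> (nat \<Rightarrow>\<^sub>0 nat) set"
  where "mono_quot k A = {u. u + xm k \<in> A}"

text \<open>For standard monomials this is the restriction to the linear space on which
  \<open>x_k\<close>, ..., \<open>x_{k+q-1}\<close> vanish.\<close>

definition avoid :: "nat \<Rightarrow> nat \<Rightarrow> (nat \<Rightarrow>\<^sub>0 nat) set \<Rightarrow> (nat \<Rightarrow>\<^sub>0 nat) set"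
  where "avoid k q A = {m\<in>A. \<forall>i. k \<le> i \<and> i < k + q \<longrightarrow> Poly_Mapping.lookup m i = 0}"

lemma avoid_0 [simp]: "avoid k 0 A = A"
  by (simp add: avoid_def)

lemma avoid_avoid: "avoid (k + q) (Suc 0) (avoid k q A) = avoid k (Suc q) A"
  by (auto simp: avoid_def less_Suc_eq)

lemma strongly_stableD:
  "strongly_stable k s A \<Longrightarrow> k \<le> i \<Longrightarrow> i < j \<Longrightarrow> u + xm j \<in> A \<Longrightarrow> u + xm i \<in> A"
  unfolding strongly_stable_def by blast

lemma finite_mono_quot: "finite A \<Longrightarrow> finite (mono_quot k A)"
  unfolding mono_quot_def by (rule finite_imageD[of "\<lambda>u. u + xm k", OF finite_subset]) (auto simp: inj_on_def)

lemma strongly_stable_quot: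
  assumes "strongly_stable k (Suc s) A" shows "strongly_stable k s (mono_quot k A)"
  unfolding strongly_stable_def
proof (intro conjI ballI allI impI)
  show "finite (mono_quot k A)" using assms finite_mono_quot by (auto simp: strongly_stable_def)
next
  fix m assume m: "m \<in> mono_quot k A"
  then have "mono_degree (m + xm k) = Suc s" and "\<forall>i<k. Poly_Mapping.lookup (m + xm k) i = 0"
    using assms by (auto simp: strongly_stable_def mono_quot_def)
  then show "mono_degree m = s" "\<And>i. i < k \<Longrightarrow> Poly_Mapping.lookup m i = 0"
    by (auto simp: mono_degree_add mono_degree_single lookup_add)
next
  fix u i j assume "k \<le> i \<and> i < j \<and> u + xm j \<in> mono_quot k A"
  then have "k \<le> i" "i < j" "(u + xm k) + xm j \<in> A" by (auto simp: mono_quot_def add_ac)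
  then have "(u + xm k) + xm i \<in> A" using assms unfolding strongly_stable_def by blast
  then show "u + xm i \<in> mono_quot k A" by (simp add: mono_quot_def add_ac)
qed

lemma strongly_stable_avoid:
  assumes "strongly_stable k s A" shows "strongly_stable (k + q) s (avoid k q A)"
  unfolding strongly_stable_def
proof (intro conjI ballI allI impI)
  show "finite (avoid k q A)" using assms by (auto simp: strongly_stable_def avoid_def)
next
  fix m assume "m \<in> avoid k q A"
  then show "mono_degree m = s" "\<And>i. i < k + q \<Longrightarrow> Poly_Mapping.lookup m i = 0"
    using assms by (auto simp: strongly_stable_def avoid_def not_less) (meson not_less)
next
  fix u i j assume u: "k + q \<le> i \<and> i < j \<and> u + xm j \<in> avoid k q A"
  then have "u + xm j \<in> A" "k \<le> i" by (auto simp: avoid_def)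
  then have "u + xm i \<in> A" using strongly_stableD[OF assms] u by blast
  then show "u + xm i \<in> avoid k q A"
    using u by (auto simp: avoid_def lookup_add lookup_single)
qed

text \<open>Splitting by divisibility by \<open>x_k\<close> is the monomial counterpart of
  \<open>hyp_hf_pascal\<close>.\<close>

lemma card_avoid_quot:
  assumes "finite A" shows "card A = card (avoid k (Suc 0) A) + card (mono_quot k A)"
proof -
  have A: "A = avoid k (Suc 0) A \<union> (\<lambda>u. u + xm k) ` mono_quot k A" (is "_ = ?B \<union> ?C")
  proof
    show "A \<subseteq> ?B \<union> ?C"
    proof
      fix m assume m: "m \<in> A"
      show "m \<in> ?B \<union> ?C"
      proof (cases "Poly_Mapping.lookup m k = 0")
        case True
        then show ?thesis using m by (auto simp: avoid_def le_less_Suc_eq)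
      next
        case False
        then obtain u where "m = u + xm k" by (rule split_xm)
        then show ?thesis using m by (auto simp: mono_quot_def)
      qed
    qed
  qed (auto simp: avoid_def mono_quot_def)
  have "?B \<inter> ?C = {}" by (auto simp: avoid_def lookup_add)
  moreover have "finite ?B" using assms by (simp add: avoid_def)
  moreover have "finite ?C" using finite_mono_quot[OF assms] by simp
  ultimately have "card (?B \<union> ?C) = card ?B + card ?C" by (rule card_Un_disjoint[rotated 2])
  moreover have "card ?C = card (mono_quot k A)" by (rule card_image) (simp add: inj_on_def)
  ultimately show ?thesis using A by simp
qed

lemma hyp_hf_zero_one: "hyp_hf r 0 (Suc 0) = 1"
  by (simp add: hyp_hf_def)

text \<open>Common core of Green's and Macaulay's bounds. By \<open>G\<close>, a small quotient
  \<open>B\<close> of \<open>A\<close> by \<open>x_k\<close> stays small under successive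
  restrictions. Stability embeds the quotient of each restriction of \<open>A\<close> by its first
  variable into the matching restriction of \<open>B\<close>, and Pascal's rule adds up these
  contributions.\<close>

lemma strongly_stable_avoid_of_quot:
  assumes G: "\<And>k A r l. \<lbrakk>strongly_stable k s A; 1 \<le> l; l \<le> s; card A \<le> hyp_hf (Suc r) s l\<rbrakk> \<Longrightarrow>
        card (avoid k (Suc 0) A) \<le> hyp_hf r s l"
    and A: "strongly_stable k (Suc s) A" and l: "1 \<le> l" "l \<le> Suc s"
    and less: "card (mono_quot k A) < hyp_hf (Suc r) s l"
  shows "card (avoid k (Suc 0) A) \<le> hyp_hf r (Suc s) l"
proof -
  define B where "B = mono_quot k A"
  have B: "strongly_stable k s B" unfolding B_def by (rule strongly_stable_quot[OF A])
  have finB: "finite (avoid k q B)" for q using B by (auto simp: avoid_def strongly_stable_def)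
  have finA: "finite (avoid k q A)" for q using A by (auto simp: avoid_def strongly_stable_def)
  \<comment> \<open>\<open>G\<close> requires \<open>l \<le> s\<close>. For \<open>l = s + 1\<close>
    the strict inequality \<open>less\<close> pays for lowering \<open>l\<close> to
    \<open>s\<close>, which costs exactly one.\<close>
  define l' where "l' = min l s"
  have l': "card (avoid k q B) \<le> hyp_hf (Suc r - q) s l'" if "s \<noteq> 0" "q \<le> Suc r" for q
    using that(2)
  proof (induction q)
    case 0
    show ?case
    proof (cases "l \<le> s")
      case True then show ?thesis using less by (simp add: l'_def B_def)
    next
      case False
      then have "l = Suc s" using l by simp
      then show ?thesis using less hyp_hf_Suc[of "Suc r" s] by (simp add: l'_def B_def)
    qed
  next
    case (Suc q)
    have "card (avoid (k + q) (Suc 0) (avoid k q B)) \<le> hyp_hf (r - q) s l'"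
    proof (rule G)
      show "strongly_stable (k + q) s (avoid k q B)" by (rule strongly_stable_avoid[OF B])
      show "1 \<le> l'" "l' \<le> s" using l that by (auto simp: l'_def)
      show "card (avoid k q B) \<le> hyp_hf (Suc (r - q)) s l'" using Suc by (simp add: Suc_diff_le)
    qed
    then show ?case by (simp add: avoid_avoid)
  qed
  have avB: "card (avoid k q B) \<le> hyp_hf (Suc r - q) s l" if q: "q \<le> Suc r" for q
  proof (cases "s = 0")
    case True
    then have "l = 1" using l by simp
    then have "card B = 0" using less True by (simp add: B_def hyp_hf_zero_one)
    then have "B = {}" using B by (simp add: strongly_stable_def)
    then show ?thesis by (simp add: avoid_def)
  next
    case False
    have "hyp_hf (Suc r - q) s l' \<le> hyp_hf (Suc r - q) s l" by (rule hyp_hf_mono) (simp add: l'_def)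
    then show ?thesis using l'[OF False q] by simp
  qed
  \<comment> \<open>For \<open>s > 0\<close>, after \<open>r + 1\<close> restrictions the bound is
    \<open>hyp_hf 0 s l'\<close>, which vanishes because \<open>l' \<le> s\<close>.\<close>
  have emB: "avoid k (Suc r) B = {}"
  proof (cases "s = 0")
    case True
    then have "l = 1" using l by simp
    then have "card B = 0" using less True by (simp add: B_def hyp_hf_zero_one)
    then have "B = {}" using B by (simp add: strongly_stable_def)
    then show ?thesis by (simp add: avoid_def)
  next
    case False
    have "hyp_hf 0 s l' = 0" by (rule hyp_hf_0) (simp add: l'_def)
    then have "card (avoid k (Suc r) B) = 0" using l'[OF False, of "Suc r"] by simp
    then show ?thesis using finB by simp
  qed
  \<comment> \<open>A monomial of \<open>A\<close> free of these variables contains some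
    \<open>x_j\<close> with \<open>j > k + r\<close>; trading one factor \<open>x_j\<close> for
    \<open>x_k\<close> would put the cofactor into the empty restriction of
    \<open>B\<close>.\<close>
  have emA: "avoid k (Suc r) A = {}"
  proof (rule ccontr)
    assume "avoid k (Suc r) A \<noteq> {}"
    then obtain m where m: "m \<in> avoid k (Suc r) A" by blast
    then have "mono_degree m \<noteq> 0" "\<forall>i<k. Poly_Mapping.lookup m i = 0"
      using A by (auto simp: avoid_def strongly_stable_def)
    then have "m \<noteq> 0" by (simp add: mono_degree_eq_0_iff)
    then obtain j where j: "Poly_Mapping.lookup m j \<noteq> 0"
      by (metis lookup_zero poly_mapping_eqI)
    then have kj: "k + Suc r \<le> j"
      using m \<open>\<forall>i<k. _\<close> unfolding avoid_def by (metis (mono_tags, lifting) mem_Collect_eq not_le)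
    obtain u where u: "m = u + xm j" using j by (rule split_xm)
    have "u + xm j \<in> A" using m u by (simp add: avoid_def)
    then have "u + xm k \<in> A" using strongly_stableD[OF A order_refl, of j u] kj by linarith
    moreover have "Poly_Mapping.lookup u i = 0" if "k \<le> i" "i < k + Suc r" for i
      using that m by (auto simp: u avoid_def lookup_add)
    ultimately have "u \<in> avoid k (Suc r) B" by (simp add: B_def mono_quot_def avoid_def)
    then show False using emB by simp
  qed
  \<comment> \<open>From the empty restriction onwards, the variables are put back one at a time;
    \<open>q\<close> is the number of those put back.\<close>
  have "card (avoid k (Suc r - q) A) \<le> hyp_hf q (Suc s) l" if "q \<le> r" for q
    using that
  proof (induction q)
    case 0 then show ?case by (simp add: emA)
  next
    case (Suc q)
    define p where "p = r - q"
    have p: "Suc r - q = Suc p" "Suc r - Suc q = p" "Suc r - p = Suc q" "p \<noteq> 0" "p \<le> Suc r"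
      using Suc.prems by (auto simp: p_def)
    have "mono_quot (k + p) (avoid k p A) \<subseteq> avoid k p B"
    proof
      fix u assume "u \<in> mono_quot (k + p) (avoid k p A)"
      then have u: "u + xm (k + p) \<in> avoid k p A" by (simp add: mono_quot_def)
      then have "u + xm (k + p) \<in> A" by (simp add: avoid_def)
      then have "u + xm k \<in> A" using strongly_stableD[OF A order_refl, of "k + p" u] p by simp
      moreover have "Poly_Mapping.lookup u i = 0" if "k \<le> i" "i < k + p" for i
        using that u by (auto simp: avoid_def lookup_add)
      ultimately show "u \<in> avoid k p B" by (simp add: B_def mono_quot_def avoid_def)
    qed
    then have "card (mono_quot (k + p) (avoid k p A)) \<le> hyp_hf (Suc q) s l"
      using card_mono[OF finB] avB[OF p(5)] p(3) by (metis le_trans)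
    moreover have "card (avoid k p A) = card (avoid k (Suc p) A) + card (mono_quot (k + p) (avoid k p A))"
      using card_avoid_quot[OF finA, of p "k + p"] by (simp add: avoid_avoid)
    ultimately show ?case using Suc p hyp_hf_pascal[of q s l] by simp
  qed
  from this[of r] show ?thesis by (simp add: Suc_diff_le)
qed

text \<open>Green's bound for the restriction to the first variable.\<close>

lemma strongly_stable_avoid_le:
  assumes "strongly_stable k s A" "1 \<le> l" "l \<le> s" "card A \<le> hyp_hf (Suc r) s l"
  shows "card (avoid k (Suc 0) A) \<le> hyp_hf r s l"
  using assms
proof (induction s arbitrary: k A r l)
  case (Suc s)
  show ?case
  proof (cases "card (mono_quot k A) < hyp_hf (Suc r) s l")
    case True
    show ?thesis by (rule strongly_stable_avoid_of_quot[OF Suc.IH Suc.prems(1-3) True])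
  next
    \<comment> \<open>A large quotient leaves little for the restriction: their counts add up to
      \<open>card A\<close>, just as the bounds do in Pascal's rule.\<close>
    case False
    moreover have "finite A" using Suc.prems by (simp add: strongly_stable_def)
    ultimately show ?thesis
      using card_avoid_quot[of A k] Suc.prems(4) hyp_hf_pascal[of r s l] by linarith
  qed
qed simp

text \<open>By contraposition: too small a quotient makes the restriction small as well, and then
  \<open>card A\<close> falls below Pascal's sum.\<close>

lemma strongly_stable_quot_ge:
  assumes A: "strongly_stable k (Suc s) A" and l: "1 \<le> l" and ge: "hyp_hf (Suc r) (Suc s) l \<le> card A"
  shows "hyp_hf (Suc r) s l \<le> card (mono_quot k A)"
proof -
  \<comment> \<open>Values of \<open>l\<close> above \<open>s + 1\<close> are lowered to
    \<open>s + 1\<close>, as the preceding lemma requires; the bound in degree \<open>s\<close> does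
    not change.\<close>
  define l' where "l' = min l (Suc s)"
  have e: "hyp_hf (Suc r) s l = hyp_hf (Suc r) s l'"
    unfolding l'_def using hyp_hf_truncate[of s l "Suc r"] by (cases "l \<le> s") (auto simp: min_def)
  have "hyp_hf (Suc r) (Suc s) l' \<le> hyp_hf (Suc r) (Suc s) l" by (rule hyp_hf_mono) (simp add: l'_def)
  then have ge': "hyp_hf (Suc r) (Suc s) l' \<le> card A" using ge by simp
  show ?thesis unfolding e
  proof (rule ccontr)
    assume less: "\<not> hyp_hf (Suc r) s l' \<le> card (mono_quot k A)"
    have "card (avoid k (Suc 0) A) \<le> hyp_hf r (Suc s) l'"
      by (rule strongly_stable_avoid_of_quot[OF strongly_stable_avoid_le A]) (use l less in \<open>auto simp: l'_def\<close>)
    moreover have "finite A" using A by (simp add: strongly_stable_def)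
    ultimately show False
      using card_avoid_quot[of A k] ge' less hyp_hf_pascal[of r s l'] by linarith
  qed
qed

section \<open>Compression and the shadow bound\<close>

text \<open>Divisors rather than multiples, because standard monomials are closed under
  division.\<close>

definition shadow :: "(nat \<Rightarrow>\<^sub>0 nat) set \<Rightarrow> (nat \<Rightarrow>\<^sub>0 nat) set"
  where "shadow A = {u. \<exists>k. u + xm k \<in> A}"

lemma shadowI: "u + xm k \<in> A \<Longrightarrow> u \<in> shadow A"
  unfolding shadow_def by blast

lemma finite_shadow: assumes "finite A" shows "finite (shadow A)"
proof (rule finite_subset)
  show "shadow A \<subseteq> (\<Union>m\<in>A. (\<lambda>k. m - xm k) ` Poly_Mapping.keys m)"
  proof
    fix u assume "u \<in> shadow A"
    then obtain k where k: "u + xm k \<in> A" by (auto simp: shadow_def)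
    have "u = (u + xm k) - xm k" by simp
    moreover have "k \<in> Poly_Mapping.keys (u + xm k)" by (simp add: in_keys_iff lookup_add)
    ultimately show "u \<in> (\<Union>m\<in>A. (\<lambda>k. m - xm k) ` Poly_Mapping.keys m)" using k by blast
  qed
qed (use assms in simp)

text \<open>\<open>redist i j m b\<close> gives \<open>x\<^sub>j\<close> the exponent \<open>b\<close> and keeps the total exponent of
  \<open>x\<^sub>i\<close> and \<open>x\<^sub>j\<close>, provided that \<open>b\<close> does not exceed that total.\<close>

definition rest :: "nat \<Rightarrow> nat \<Rightarrow> (nat \<Rightarrow>\<^sub>0 nat) \<Rightarrow> (nat \<Rightarrow>\<^sub>0 nat)"
  where "rest i j m = Poly_Mapping.update i 0 (Poly_Mapping.update j 0 m)"

definition redist :: "nat \<Rightarrow> nat \<Rightarrow> (nat \<Rightarrow>\<^sub>0 nat) \<Rightarrow> nat \<Rightarrow> (nat \<Rightarrow>\<^sub>0 nat)"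
  where "redist i j m b = rest i j m +
    Poly_Mapping.single i (Poly_Mapping.lookup m i + Poly_Mapping.lookup m j - b) +
    Poly_Mapping.single j b"

definition fibre :: "nat \<Rightarrow> nat \<Rightarrow> (nat \<Rightarrow>\<^sub>0 nat) set \<Rightarrow> (nat \<Rightarrow>\<^sub>0 nat) \<Rightarrow> nat set"
  where "fibre i j A m =
    {b. b \<le> Poly_Mapping.lookup m i + Poly_Mapping.lookup m j \<and> redist i j m b \<in> A}"

text \<open>On each segment of monomials with fixed total exponent in \<open>x_i\<close>,
  \<open>x_j\<close> and all other exponents fixed, \<open>A\<close> is replaced by equally many
  monomials with the smallest exponents of \<open>x_j\<close>.\<close>

definition compress :: "nat \<Rightarrow> nat \<Rightarrow> (nat \<Rightarrow>\<^sub>0 nat) set \<Rightarrow> (nat \<Rightarrow>\<^sub>0 nat) set"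
  where "compress i j A = {m. Poly_Mapping.lookup m j < card (fibre i j A m)}"

definition rank :: "nat \<Rightarrow> nat \<Rightarrow> (nat \<Rightarrow>\<^sub>0 nat) set \<Rightarrow> (nat \<Rightarrow>\<^sub>0 nat) \<Rightarrow> nat"
  where "rank i j A m = card {b\<in>fibre i j A m. b < Poly_Mapping.lookup m j}"

lemma finite_fibre [simp]: "finite (fibre i j A m)"
  by (rule finite_subset[of _ "{..Poly_Mapping.lookup m i + Poly_Mapping.lookup m j}"])
    (auto simp: fibre_def)

lemma lookup_rest:
  "Poly_Mapping.lookup (rest i j m) t = (if t = i \<or> t = j then 0 else Poly_Mapping.lookup m t)"
  by (simp add: rest_def lookup_update)

lemma lookup_redist:
  assumes "i \<noteq> j"
  shows "Poly_Mapping.lookup (redist i j m b) t =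
    (if t = j then b
     else if t = i then Poly_Mapping.lookup m i + Poly_Mapping.lookup m j - b
     else Poly_Mapping.lookup m t)"
  using assms by (simp add: redist_def lookup_add lookup_rest lookup_single when_def)

lemma redist_self: "i \<noteq> j \<Longrightarrow> redist i j m (Poly_Mapping.lookup m j) = m"
  by (rule poly_mapping_eqI) (simp add: lookup_redist)

lemma redist_redist:
  assumes "i \<noteq> j" "b \<le> Poly_Mapping.lookup m i + Poly_Mapping.lookup m j"
  shows "redist i j (redist i j m b) c = redist i j m c"
  using assms by (intro poly_mapping_eqI) (simp add: lookup_redist)

lemma fibre_redist:
  assumes "i \<noteq> j" "b \<le> Poly_Mapping.lookup m i + Poly_Mapping.lookup m j"
  shows "fibre i j A (redist i j m b) = fibre i j A m"
  using assms by (simp add: fibre_def redist_redist lookup_redist)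

lemma weight_redist:
  "weight w (redist i j m b) = weight w (rest i j m)
    + w i * (Poly_Mapping.lookup m i + Poly_Mapping.lookup m j - b) + w j * b"
  by (simp add: redist_def weight_add weight_single)

lemma mono_degree_redist:
  assumes "i \<noteq> j" "b \<le> Poly_Mapping.lookup m i + Poly_Mapping.lookup m j"
  shows "mono_degree (redist i j m b) = mono_degree m"
proof -
  have "mono_degree (redist i j m b) = mono_degree (redist i j m (Poly_Mapping.lookup m j))"
    using assms by (simp add: mono_degree_weight weight_redist)
  then show ?thesis using assms by (simp add: redist_self)
qed

lemma card_below_inj:
  assumes "finite (F :: nat set)" shows "inj_on (\<lambda>b. card {x\<in>F. x < b}) F"
proof (rule linorder_inj_onI)
  fix a b assume ab: "a < b" "a \<in> F" "b \<in> F"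
  have "card {x\<in>F. x < a} < card {x\<in>F. x < b}"
    by (rule psubset_card_mono) (use ab assms in auto)
  then show "card {x\<in>F. x < a} \<noteq> card {x\<in>F. x < b}" by simp
qed auto

lemma card_below_image:
  assumes "finite (F :: nat set)" shows "(\<lambda>b. card {x\<in>F. x < b}) ` F = {..<card F}"
proof (rule card_subset_eq)
  show "(\<lambda>b. card {x\<in>F. x < b}) ` F \<subseteq> {..<card F}"
    using assms by (auto intro!: psubset_card_mono)
  show "card ((\<lambda>b. card {x\<in>F. x < b}) ` F) = card {..<card F}"
    using card_image[OF card_below_inj[OF assms]] by simp
qed simp

lemma rank_le: "rank i j A m \<le> Poly_Mapping.lookup m j"
proof -
  have "rank i j A m \<le> card {..<Poly_Mapping.lookup m j}"
    unfolding rank_def by (rule card_mono) auto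
  then show ?thesis by simp
qed

lemma in_fibre_self:
  assumes "i \<noteq> j" "m \<in> A" shows "Poly_Mapping.lookup m j \<in> fibre i j A m"
  using assms by (simp add: fibre_def redist_self)

text \<open>Within a fibre the map renumbers the exponents of \<open>x_j\<close> in increasing order
  from \<open>0\<close>, which is a bijection onto an initial segment. Fibres are preserved, so they
  do not interfere with each other.\<close>

lemma compress_image:
  assumes ij: "i \<noteq> j"
  shows "bij_betw (\<lambda>m. redist i j m (rank i j A m)) A (compress i j A)"
  unfolding bij_betw_def
proof
  let ?r = "rank i j A"
  show "inj_on (\<lambda>m. redist i j m (?r m)) A"
  proof (rule inj_onI)
    fix m m' assume mm: "m \<in> A" "m' \<in> A" "redist i j m (?r m) = redist i j m' (?r m')"
    have rk: "?r m \<le> Poly_Mapping.lookup m j" "?r m' \<le> Poly_Mapping.lookup m' j"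
      by (rule rank_le)+
    have eq: "redist i j m c = redist i j m' c" for c
      using mm(3) redist_redist[OF ij, of "?r m" m c] redist_redist[OF ij, of "?r m'" m' c] rk
      by simp
    have eqf: "fibre i j A m = fibre i j A m'"
      using mm(3) fibre_redist[OF ij, of "?r m" m A] fibre_redist[OF ij, of "?r m'" m' A] rk
      by simp
    have "?r m = ?r m'"
      using arg_cong[OF mm(3), of "\<lambda>m. Poly_Mapping.lookup m j"] ij by (simp add: lookup_redist)
    then have "card {b\<in>fibre i j A m. b < Poly_Mapping.lookup m j} =
        card {b\<in>fibre i j A m. b < Poly_Mapping.lookup m' j}"
      by (simp add: rank_def eqf)
    moreover have "Poly_Mapping.lookup m' j \<in> fibre i j A m"
      unfolding eqf by (rule in_fibre_self[OF ij mm(2)])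
    ultimately have "Poly_Mapping.lookup m j = Poly_Mapping.lookup m' j"
      using inj_onD[OF card_below_inj[OF finite_fibre] _ in_fibre_self[OF ij mm(1)]] by blast
    then show "m = m'" using eq redist_self[OF ij] by metis
  qed
  show "(\<lambda>m. redist i j m (?r m)) ` A = compress i j A"
  proof (intro equalityI subsetI)
    fix x assume "x \<in> (\<lambda>m. redist i j m (?r m)) ` A"
    then obtain m where m: "m \<in> A" "x = redist i j m (?r m)" by blast
    have "?r m < card (fibre i j A m)"
      unfolding rank_def using in_fibre_self[OF ij m(1)] by (intro psubset_card_mono) auto
    moreover have "fibre i j A x = fibre i j A m"
      using m rank_le[of i j A m] by (simp add: fibre_redist[OF ij])
    ultimately show "x \<in> compress i j A" using ij by (simp add: compress_def m lookup_redist)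
  next
    fix x assume "x \<in> compress i j A"
    then have "Poly_Mapping.lookup x j \<in> {..<card (fibre i j A x)}" by (simp add: compress_def)
    then obtain b where b: "b \<in> fibre i j A x"
        "Poly_Mapping.lookup x j = card {y\<in>fibre i j A x. y < b}"
      unfolding card_below_image[OF finite_fibre, symmetric] by blast
    define m where "m = redist i j x b"
    have bl: "b \<le> Poly_Mapping.lookup x i + Poly_Mapping.lookup x j" and mA: "m \<in> A"
      using b(1) by (auto simp: fibre_def m_def)
    have "?r m = Poly_Mapping.lookup x j"
      unfolding rank_def m_def fibre_redist[OF ij bl] using b(2)
      by (simp add: lookup_redist[OF ij])
    then have "redist i j m (?r m) = x"
      by (simp add: m_def redist_redist[OF ij bl] redist_self[OF ij])
    then show "x \<in> (\<lambda>m. redist i j m (?r m)) ` A" using mA by (metis imageI)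
  qed
qed

text \<open>Here \<open>F\<close> stands for a fibre of total exponent \<open>e + 1\<close> and
  \<open>F'\<close> for one of its shadow. Unless \<open>F\<close> is the full interval it misses
  some \<open>v\<close>, and lowering the elements above \<open>v\<close> by one embeds
  \<open>F\<close> into \<open>F'\<close>.\<close>

lemma card_shrunk_interval:
  assumes F: "F \<subseteq> {..Suc e}" and F': "finite F'"
    and a: "\<And>b. b \<in> F \<Longrightarrow> b \<noteq> 0 \<Longrightarrow> b - 1 \<in> F'" and b: "\<And>b. b \<in> F \<Longrightarrow> b \<le> e \<Longrightarrow> b \<in> F'"
  shows "min (card F) (Suc e) \<le> card F'"
proof (cases "F = {..Suc e}")
  case True
  then have "{..e} \<subseteq> F'" using b by auto
  then have "card {..e} \<le> card F'" by (rule card_mono[OF F'])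
  then show ?thesis by simp
next
  case False
  then obtain v where v: "v \<le> Suc e" "v \<notin> F" using F by auto
  let ?g = "\<lambda>b. if b < v then b else b - 1"
  have "inj_on ?g F"
  proof (rule linorder_inj_onI)
    fix x y assume "x < y" "x \<in> F" "y \<in> F"
    then show "?g x \<noteq> ?g y" using v by (cases "x = v"; cases "y = v") auto
  qed auto
  moreover have "?g ` F \<subseteq> F'"
  proof
    fix y assume "y \<in> ?g ` F"
    then obtain x where x: "x \<in> F" "y = ?g x" by blast
    then show "y \<in> F'" using v a[of x] b[of x] by (cases "x = v") auto
  qed
  ultimately have "card F \<le> card F'" by (rule card_inj_on_le) (rule F')
  then show ?thesis by simp
qed

text \<open>The fibres over \<open>m = u + xm k\<close> and over \<open>u\<close> are compared. If
  \<open>k\<close> is neither \<open>i\<close> nor \<open>j\<close>, the totals agree and the first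
  fibre is contained in the second; otherwise the total drops by one and the interval lemma
  applies.\<close>

lemma shadow_compress:
  assumes ij: "i \<noteq> j" shows "shadow (compress i j A) \<subseteq> compress i j (shadow A)"
proof
  fix u assume "u \<in> shadow (compress i j A)"
  then obtain k where k: "u + xm k \<in> compress i j A" by (auto simp: shadow_def)
  define m where "m = u + xm k"
  have f: "Poly_Mapping.lookup m j < card (fibre i j A m)" using k by (simp add: compress_def m_def)
  show "u \<in> compress i j (shadow A)"
  proof (cases "k = i \<or> k = j")
    case False
    have key: "redist i j u b + xm k = redist i j m b" for b
      using False by (intro poly_mapping_eqI)
        (simp add: lookup_redist[OF ij] m_def lookup_add lookup_single when_def)
    have "redist i j u b \<in> shadow A" if "redist i j m b \<in> A" for b
      using that unfolding key[symmetric] by (rule shadowI)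
    moreover have "Poly_Mapping.lookup m i = Poly_Mapping.lookup u i"
        "Poly_Mapping.lookup m j = Poly_Mapping.lookup u j"
      using False by (simp_all add: m_def lookup_add lookup_single)
    ultimately have "fibre i j A m \<subseteq> fibre i j (shadow A) u"
      by (auto simp: fibre_def)
    then have "card (fibre i j A m) \<le> card (fibre i j (shadow A) u)" by (intro card_mono) auto
    then show ?thesis using f False by (simp add: compress_def m_def lookup_add lookup_single)
  next
    case True
    define e where "e = Poly_Mapping.lookup u i + Poly_Mapping.lookup u j"
    have e: "Poly_Mapping.lookup m i + Poly_Mapping.lookup m j = Suc e"
      using True ij by (auto simp: e_def m_def lookup_add lookup_single)
    have oth: "Poly_Mapping.lookup m t = Poly_Mapping.lookup u t" if "t \<noteq> i" "t \<noteq> j" for t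
      using that True by (auto simp: m_def lookup_add lookup_single)
    have "min (card (fibre i j A m)) (Suc e) \<le> card (fibre i j (shadow A) u)"
    proof (rule card_shrunk_interval)
      show "fibre i j A m \<subseteq> {..Suc e}" by (auto simp: fibre_def e)
      show "finite (fibre i j (shadow A) u)" by simp
    next
      fix b assume b: "b \<in> fibre i j A m" "b \<noteq> 0"
      have key: "redist i j u (b - 1) + xm j = redist i j m b"
        using b ij by (intro poly_mapping_eqI)
          (auto simp: lookup_redist lookup_add lookup_single when_def oth e e_def[symmetric])
      have "redist i j m b \<in> A" using b(1) by (simp add: fibre_def)
      then have "redist i j u (b - 1) \<in> shadow A" unfolding key[symmetric] by (rule shadowI)
      then show "b - 1 \<in> fibre i j (shadow A) u"
        using b by (auto simp: fibre_def e e_def[symmetric])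
    next
      fix b assume b: "b \<in> fibre i j A m" "b \<le> e"
      have key: "redist i j u b + xm i = redist i j m b"
        using b ij by (intro poly_mapping_eqI)
          (auto simp: lookup_redist lookup_add lookup_single when_def oth e e_def[symmetric])
      have "redist i j m b \<in> A" using b(1) by (simp add: fibre_def)
      then have "redist i j u b \<in> shadow A" unfolding key[symmetric] by (rule shadowI)
      then show "b \<in> fibre i j (shadow A) u"
        using b by (simp add: fibre_def e_def[symmetric])
    qed
    \<comment> \<open>The bound by \<open>e\<close> deals with the minimum: a full fibre loses one
      element, but the exponent in question still fits.\<close>
    moreover have "Poly_Mapping.lookup u j \<le> Poly_Mapping.lookup m j" "Poly_Mapping.lookup u j \<le> e"
      by (simp_all add: m_def lookup_add e_def)
    ultimately show ?thesis using f by (simp add: compress_def)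
  qed
qed

text \<open>Extremal choice: among sets of the same degree and size with no larger shadow, take one
  of least total index weight. Compressions towards smaller indices stay in this class and lower the
  weight unless nothing moves, so the minimal set is fixed by all of them, which yields
  stability.\<close>

lemma exists_stable:
  assumes "finite A" "\<And>m. m \<in> A \<Longrightarrow> mono_degree m = s"
  obtains B where "strongly_stable 0 s B" "card B = card A" "card (shadow B) \<le> card (shadow A)"
proof -
  define P where "P B \<longleftrightarrow> finite B \<and> (\<forall>m\<in>B. mono_degree m = s) \<and> card B = card A \<and>
    card (shadow B) \<le> card (shadow A)" for B
  \<comment> \<open>\<open>weight id\<close> counts every variable with its index, so moving
    exponent from \<open>x_j\<close> to \<open>x_i\<close> with \<open>i < j\<close> decreases
    it.\<close>
  define \<Phi> where "\<Phi> B = (\<Sum>m\<in>B. weight id m)" for B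
  have "P A" using assms by (simp add: P_def)
  then obtain B where B: "P B" and min: "\<And>C. P C \<Longrightarrow> \<Phi> B \<le> \<Phi> C"
    using ex_has_least_nat[of P A \<Phi>] by blast
  have finB: "finite B" using B by (simp add: P_def)
  have "strongly_stable 0 s B"
    unfolding strongly_stable_def
  proof (intro conjI ballI allI impI)
    fix u i j assume uij: "0 \<le> i \<and> i < j \<and> u + xm j \<in> B"
    then have ij: "i \<noteq> j" and ij': "i < j" by auto
    let ?\<sigma> = "\<lambda>m. redist i j m (rank i j B m)"
    define C where "C = compress i j B"
    have bij: "bij_betw ?\<sigma> B C" unfolding C_def by (rule compress_image[OF ij])
    have rl: "rank i j B m \<le> Poly_Mapping.lookup m j" for m by (rule rank_le)
    have PC: "P C"
      unfolding P_def
    proof (intro conjI ballI)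
      show "finite C" using bij finB bij_betw_finite by blast
      show "card C = card A" using bij_betw_same_card[OF bij] B by (simp add: P_def)
      have "shadow C \<subseteq> compress i j (shadow B)" unfolding C_def by (rule shadow_compress[OF ij])
      moreover have fc: "finite (compress i j (shadow B))"
        using compress_image[OF ij, of "shadow B"] finite_shadow[OF finB] bij_betw_finite by blast
      ultimately have "card (shadow C) \<le> card (compress i j (shadow B))" by (intro card_mono)
      also have "\<dots> = card (shadow B)"
        using bij_betw_same_card[OF compress_image[OF ij, of "shadow B"]] by simp
      also have "\<dots> \<le> card (shadow A)" using B by (simp add: P_def)
      finally show "card (shadow C) \<le> card (shadow A)" .
    next
      fix x assume "x \<in> C"
      then obtain m where "m \<in> B" "x = ?\<sigma> m" using bij by (auto simp: bij_betw_def)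
      then show "mono_degree x = s"
        using B rl[of m] by (simp add: P_def mono_degree_redist[OF ij])
    qed
    have wt: "weight id m = weight id (?\<sigma> m) +
        (j - i) * (Poly_Mapping.lookup m j - rank i j B m)" for m
    proof -
      obtain c where c: "Poly_Mapping.lookup m j = rank i j B m + c" using rl[of m] le_Suc_ex by blast
      obtain t where t: "j = i + t" using ij' less_imp_add_positive by blast
      have "weight id m = weight id (redist i j m (Poly_Mapping.lookup m j))"
        by (simp add: redist_self[OF ij])
      then show ?thesis unfolding weight_redist c by (simp add: t algebra_simps)
    qed
    have "\<Phi> C = (\<Sum>m\<in>B. weight id (?\<sigma> m))"
      unfolding \<Phi>_def by (rule sum.reindex_bij_betw[OF bij, symmetric])
    moreover have "\<Phi> B = (\<Sum>m\<in>B. weight id (?\<sigma> m)) +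
        (\<Sum>m\<in>B. (j - i) * (Poly_Mapping.lookup m j - rank i j B m))"
      unfolding \<Phi>_def sum.distrib[symmetric] by (rule sum.cong[OF refl]) (rule wt)
    ultimately have "(\<Sum>m\<in>B. (j - i) * (Poly_Mapping.lookup m j - rank i j B m)) = 0"
      using min[OF PC] by simp
    then have all: "Poly_Mapping.lookup m j = rank i j B m" if "m \<in> B" for m
      using that finB ij' rl[of m] by auto
    define m where "m = u + xm j"
    have "m \<in> B" using uij by (simp add: m_def)
    define L where "L = {b\<in>fibre i j B m. b < Poly_Mapping.lookup m j}"
    \<comment> \<open>An exponent equal to its rank has every smaller exponent in its fibre, in
      particular the next lower one, which belongs to \<open>u + xm i\<close>.\<close>
    have "L = {..<Poly_Mapping.lookup m j}"
    proof (rule card_subset_eq)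
      show "card L = card {..<Poly_Mapping.lookup m j}"
        using all[OF \<open>m \<in> B\<close>] by (simp add: rank_def L_def)
    qed (auto simp: L_def)
    moreover have "Poly_Mapping.lookup u j < Poly_Mapping.lookup m j"
      by (simp add: m_def lookup_add)
    ultimately have "Poly_Mapping.lookup u j \<in> L" by simp
    then have "redist i j m (Poly_Mapping.lookup u j) \<in> B" by (simp add: L_def fibre_def)
    moreover have "redist i j m (Poly_Mapping.lookup u j) = u + xm i"
      using ij by (intro poly_mapping_eqI)
        (auto simp: lookup_redist lookup_add lookup_single when_def m_def)
    ultimately show "u + xm i \<in> B" by simp
  qed (use B in \<open>auto simp: P_def\<close>)
  then show ?thesis using that B by (simp add: P_def)
qed

text \<open>The case of Macaulay's growth bound in which the binomial expansion is that of a
  hypersurface.\<close>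

lemma macaulay_shadow:
  assumes "finite A" "\<And>m. m \<in> A \<Longrightarrow> mono_degree m = Suc s"
    and "1 \<le> l" "hyp_hf (Suc r) (Suc s) l \<le> card A"
  shows "hyp_hf (Suc r) s l \<le> card (shadow A)"
proof -
  obtain B where B: "strongly_stable 0 (Suc s) B" "card B = card A" "card (shadow B) \<le> card (shadow A)"
    using exists_stable[OF assms(1,2)] by blast
  have "hyp_hf (Suc r) s l \<le> card (mono_quot 0 B)"
    using strongly_stable_quot_ge[OF B(1) assms(3)] B(2) assms(4) by simp
  also have "\<dots> \<le> card (shadow B)"
  proof (rule card_mono)
    show "finite (shadow B)" using B(1) by (intro finite_shadow) (simp add: strongly_stable_def)
  qed (auto simp: mono_quot_def shadow_def)
  finally show ?thesis using B(3) by simp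
qed

section \<open>Standard monomials\<close>

lemma lookup_Const_mult [simp]:
  "Poly_Mapping.lookup (Const a * p) m = a * Poly_Mapping.lookup p m"
  unfolding Const_def
  by (subst mult_map_scale_conv_mult[symmetric]) (simp add: Poly_Mapping.map.rep_eq when_def)

lemma Const_0 [simp]: "Const 0 = 0"
  and Const_1 [simp]: "Const 1 = 1"
  and Const_add: "Const (a + b) = Const a + Const b"
  and Const_mult: "Const (a * b) = Const a * Const b"
  and Const_minus: "Const (- a) = - Const a"
  by (simp_all add: Const_def single_add mult_single single_uminus)

interpretation mp: vector_space "\<lambda>(a::'k::field) (p::'k mpoly). Const a * p"
  by unfold_locales (simp_all add: Const_add Const_mult algebra_simps)

abbreviation mon :: "(nat \<Rightarrow>\<^sub>0 nat) \<Rightarrow> 'k::field mpoly"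
  where "mon m \<equiv> Poly_Mapping.single m 1"

lemma Const_mon: "Const a * mon m = Poly_Mapping.single m a"
  by (simp add: Const_def mult_single)

lemma mpoly_eq_sum:
  assumes "finite B" "Poly_Mapping.keys p \<subseteq> B"
  shows "p = (\<Sum>m\<in>B. Const (Poly_Mapping.lookup p m) * mon m)"
  using assms by (intro poly_mapping_eqI)
    (auto simp: Const_mon lookup_sum lookup_single when_def in_keys_iff sum.delta')

lemma lookup_sum_mon:
  assumes "finite B"
  shows "Poly_Mapping.lookup (\<Sum>m\<in>B. Const (a m) * mon m) x = (if x \<in> B then a x else 0)"
  using assms by (simp add: Const_mon lookup_sum lookup_single when_def sum.delta')

lemma keys_sum_mon:
  "finite B \<Longrightarrow> Poly_Mapping.keys (\<Sum>m\<in>B. Const (a m) * mon m) \<subseteq> B"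
  by (auto simp: in_keys_iff lookup_sum_mon split: if_splits)

lemma lookup_mon_mult:
  "Poly_Mapping.lookup (mon e * (p::'k::field mpoly)) (e + x) = Poly_Mapping.lookup p x"
proof -
  have "mon e * p = (\<Sum>m\<in>Poly_Mapping.keys p. Poly_Mapping.single (e + m) (Poly_Mapping.lookup p m))"
    by (subst mpoly_eq_sum[of "Poly_Mapping.keys p"])
      (simp_all add: sum_distrib_left Const_mon mult_single)
  then show ?thesis
    by (auto simp: lookup_sum lookup_single when_def in_keys_iff sum.delta')
qed

lemma keys_mon_mult:
  "Poly_Mapping.keys (mon e * (p::'k::field mpoly)) = (+) e ` Poly_Mapping.keys p"
proof
  show "Poly_Mapping.keys (mon e * p) \<subseteq> (+) e ` Poly_Mapping.keys p"
    using keys_mult[of "mon e" p] by auto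
  show "(+) e ` Poly_Mapping.keys p \<subseteq> Poly_Mapping.keys (mon e * p)"
    by (auto simp: in_keys_iff lookup_mon_mult)
qed

text \<open>The maximum is taken in the linear order on exponent vectors, which is compatible with
  addition. For \<open>0\<close> the value is unspecified, so every use concerns a nonzero
  polynomial.\<close>

definition lead :: "'k::field mpoly \<Rightarrow> (nat \<Rightarrow>\<^sub>0 nat)"
  where "lead p = Max (Poly_Mapping.keys p)"

definition std :: "'k::field mpoly set \<Rightarrow> (nat \<Rightarrow>\<^sub>0 nat) set \<Rightarrow> (nat \<Rightarrow>\<^sub>0 nat) set"
  where "std V B = {m\<in>B. \<forall>f\<in>V. f \<noteq> 0 \<longrightarrow> lead f \<noteq> m}"

lemma lead_in_keys: "p \<noteq> 0 \<Longrightarrow> lead p \<in> Poly_Mapping.keys p"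
  unfolding lead_def by (rule Max_in) simp_all

lemma lead_ge: "m \<in> Poly_Mapping.keys p \<Longrightarrow> m \<le> lead p"
  unfolding lead_def by (rule Max_ge) simp_all

lemma lead_mon_mult:
  assumes "p \<noteq> (0::'k::field mpoly)" shows "lead (mon e * p) = e + lead p"
  unfolding lead_def[of "mon e * p"]
  using lead_in_keys[OF assms] by (intro Max_eqI) (auto simp: keys_mon_mult lead_ge)

definition poly_span :: "(nat \<Rightarrow>\<^sub>0 nat) set \<Rightarrow> 'k::field mpoly set"
  where "poly_span B = {p. Poly_Mapping.keys p \<subseteq> B}"

lemma subspace_poly_span: "mp.subspace (poly_span B)"
  unfolding mp.subspace_def poly_span_def
  by (auto dest!: subsetD[OF Poly_Mapping.keys_add] simp: in_keys_iff)

text \<open>Gaussian elimination: a nonstandard \<open>m\<close> is the lead of some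
  \<open>f \<in> V\<close>, which rewrites it through smaller monomials of \<open>B\<close>. The
  induction counts the elements of \<open>B\<close> below \<open>m\<close>. The bound by
  \<open>m\<close> later controls the leads of the linear forms.\<close>

lemma normal_form_mon:
  fixes V :: "'k::field mpoly set"
  assumes V: "mp.subspace V" "V \<subseteq> poly_span B" and B: "finite B" and "m \<in> B"
  shows "\<exists>g. Poly_Mapping.keys g \<subseteq> std V B \<inter> {..m} \<and> mon m - g \<in> V"
  using assms(4)
proof (induction "card {x\<in>B. x < m}" arbitrary: m rule: less_induct)
  case less
  show ?case
  proof (cases "m \<in> std V B")
    case True
    then show ?thesis using mp.subspace_0[OF V(1)] by (intro exI[of _ "mon m"]) auto
  next
    case False
    then obtain f where f: "f \<in> V" "f \<noteq> 0" "lead f = m" using less.prems by (auto simp: std_def)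
    define c where "c = Poly_Mapping.lookup f m"
    have c: "c \<noteq> 0" using lead_in_keys[OF f(2)] f(3) by (simp add: c_def in_keys_iff)
    define K where "K = Poly_Mapping.keys f - {m}"
    have K: "x \<in> B" "x < m" if "x \<in> K" for x
      using that V(2) f lead_ge[of x f] by (auto simp: K_def poly_span_def)
    have "\<exists>g. Poly_Mapping.keys g \<subseteq> std V B \<inter> {..x} \<and> mon x - g \<in> V" if "x \<in> K" for x
    proof (rule less.hyps)
      show "x \<in> B" by (rule K[OF that])
      show "card {y\<in>B. y < x} < card {y\<in>B. y < m}"
        using K[OF that] B by (intro psubset_card_mono) auto
    qed
    then obtain g where g: "\<And>x. x \<in> K \<Longrightarrow> Poly_Mapping.keys (g x) \<subseteq> std V B \<inter> {..x}"
        "\<And>x. x \<in> K \<Longrightarrow> mon x - g x \<in> V" by metis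
    define a where "a x = Poly_Mapping.lookup f x / c" for x
    define G where "G = - (\<Sum>x\<in>K. Const (a x) * g x)"
    have "finite K" by (simp add: K_def)
    have "f = Const c * mon m + (\<Sum>x\<in>K. Const (Poly_Mapping.lookup f x) * mon x)"
    proof -
      have "m \<notin> K" "Poly_Mapping.keys f \<subseteq> insert m K" by (auto simp: K_def)
      then show ?thesis
        using mpoly_eq_sum[of "insert m K" f] \<open>finite K\<close> by (simp add: c_def)
    qed
    then have "Const (1 / c) * f = Const (1 / c) * Const c * mon m
        + (\<Sum>x\<in>K. Const (1 / c) * Const (Poly_Mapping.lookup f x) * mon x)"
      by (metis (no_types, lifting) distrib_left mult.assoc sum.cong sum_distrib_left)
    then have f': "Const (1 / c) * f = mon m + (\<Sum>x\<in>K. Const (a x) * mon x)"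
      using c by (simp add: a_def Const_mult[symmetric])
    have "mon m - G = Const (1 / c) * f - (\<Sum>x\<in>K. Const (a x) * (mon x - g x))"
      unfolding f' G_def by (simp add: right_diff_distrib sum_subtractf)
    moreover have "\<dots> \<in> V"
      by (intro mp.subspace_diff[OF V(1)] mp.subspace_scale[OF V(1)] mp.subspace_sum[OF V(1)] f g)
    ultimately have "mon m - G \<in> V" by simp
    moreover have "Poly_Mapping.keys G \<subseteq> std V B \<inter> {..m}"
    proof -
      have "G \<in> poly_span (std V B \<inter> {..m})"
        unfolding G_def
      proof (intro mp.subspace_neg mp.subspace_sum mp.subspace_scale subspace_poly_span)
        fix x assume "x \<in> K"
        then show "g x \<in> poly_span (std V B \<inter> {..m})"
          using g(1)[of x] K(2)[of x] by (fastforce simp: poly_span_def)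
      qed
      then show ?thesis by (simp add: poly_span_def)
    qed
    ultimately show ?thesis by blast
  qed
qed

section \<open>Independence and spanning modulo a subspace\<close>

definition indep_mod :: "'k::field mpoly set \<Rightarrow> ('i \<Rightarrow> 'k mpoly) \<Rightarrow> 'i set \<Rightarrow> bool"
  where "indep_mod V g C \<longleftrightarrow> (\<forall>a. (\<Sum>c\<in>C. Const (a c) * g c) \<in> V \<longrightarrow> (\<forall>c\<in>C. a c = 0))"

text \<open>Indexed families are used, as in \<open>indep_mod\<close>, because a later basis is
  indexed by a disjoint sum of two sets of monomials.\<close>

definition span_mod :: "'k::field mpoly set \<Rightarrow> 'k mpoly set \<Rightarrow> ('i \<Rightarrow> 'k mpoly) \<Rightarrow> 'i set \<Rightarrow> bool"
  where "span_mod V E g C \<longleftrightarrow> (\<forall>f\<in>E. \<exists>a. f - (\<Sum>c\<in>C. Const (a c) * g c) \<in> V)"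

lemma indep_modD: "indep_mod V g C \<Longrightarrow> (\<Sum>c\<in>C. Const (a c) * g c) \<in> V \<Longrightarrow> c \<in> C \<Longrightarrow> a c = 0"
  unfolding indep_mod_def by blast

lemma indep_mod_zero:
  assumes "finite C" "indep_mod {0} g C"
  shows "inj_on g C" "\<not> mp.dependent (g ` C)"
proof -
  show inj: "inj_on g C"
  proof (rule inj_onI, rule ccontr)
    fix x y assume xy: "x \<in> C" "y \<in> C" "g x = g y" "x \<noteq> y"
    have "(\<Sum>c\<in>C. Const (if c = x then 1 else if c = y then - 1 else 0) * g c) =
      (\<Sum>c\<in>C. (if c = x then g x else 0) + (if c = y then - g x else 0))"
      using xy by (intro sum.cong) (auto simp: Const_minus)
    also have "\<dots> = 0" using assms(1) xy by (simp add: sum.distrib)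
    finally have "(if x = x then 1 else if x = y then - 1 else 0 :: 'b) = 0"
      by (intro indep_modD[OF assms(2) _ xy(1)]) simp
    then show False by simp
  qed
  show "\<not> mp.dependent (g ` C)"
  proof
    assume "mp.dependent (g ` C)"
    then obtain u where u: "\<exists>v\<in>g ` C. u v \<noteq> 0" "(\<Sum>v\<in>g ` C. Const (u v) * v) = 0"
      unfolding mp.dependent_finite[OF finite_imageI[OF assms(1)]] by blast
    have "(\<Sum>c\<in>C. Const (u (g c)) * g c) = 0" using u(2) by (simp add: sum.reindex[OF inj])
    then have "u (g c) = 0" if "c \<in> C" for c
      using indep_modD[OF assms(2), of "\<lambda>c. u (g c)", OF _ that] by simp
    then show False using u(1) by blast
  qed
qed

text \<open>Exchange in the quotient: each \<open>g c\<close> is congruent modulo \<open>V\<close>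
  to a combination \<open>G c\<close> of the spanning family. A relation among the
  \<open>G c\<close> gives one among the \<open>g c\<close> modulo \<open>V\<close>, so the
  \<open>G c\<close> are independent inside a span of at most \<open>card D\<close>
  elements.\<close>

lemma card_indep_mod_le:
  assumes V: "mp.subspace V" and C: "finite C" "indep_mod V g C" "\<And>c. c \<in> C \<Longrightarrow> g c \<in> E"
    and D: "finite D" "span_mod V E h D"
  shows "card C \<le> card D"
proof -
  have "\<forall>c\<in>C. \<exists>a. g c - (\<Sum>d\<in>D. Const (a d) * h d) \<in> V"
    using C(3) D(2) unfolding span_mod_def by blast
  then obtain a where a: "\<And>c. c \<in> C \<Longrightarrow> g c - (\<Sum>d\<in>D. Const (a c d) * h d) \<in> V" by metis
  define G where "G c = (\<Sum>d\<in>D. Const (a c d) * h d)" for c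
  have "indep_mod {0} G C"
    unfolding indep_mod_def
  proof (intro allI impI)
    fix b assume b: "(\<Sum>c\<in>C. Const (b c) * G c) \<in> {0}"
    have "(\<Sum>c\<in>C. Const (b c) * g c) = (\<Sum>c\<in>C. Const (b c) * (g c - G c))"
      using b by (simp add: right_diff_distrib sum_subtractf)
    also have "\<dots> \<in> V"
      using a by (intro mp.subspace_sum[OF V] mp.subspace_scale[OF V]) (simp add: G_def)
    finally show "\<forall>c\<in>C. b c = 0" using indep_modD[OF C(2)] by blast
  qed
  note G = indep_mod_zero[OF C(1) this]
  have "G ` C \<subseteq> mp.span (h ` D)"
    unfolding G_def
    by (intro image_subsetI mp.span_sum mp.span_scale) (simp add: mp.span_base)
  then have "card (G ` C) \<le> card (h ` D)"
    using mp.independent_span_bound[OF _ G(2)] D(1) by blast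
  also have "\<dots> \<le> card D" by (rule card_image_le[OF D(1)])
  finally show ?thesis using card_image[OF G(1)] by simp
qed

text \<open>A nonzero combination of standard monomials has a standard lead, which no nonzero
  element of \<open>V\<close> has.\<close>

lemma std_indep_mod:
  assumes "finite B" shows "indep_mod V mon (std V B)"
  unfolding indep_mod_def
proof (intro allI impI)
  fix a assume a: "(\<Sum>m\<in>std V B. Const (a m) * mon m) \<in> V" (is "?p \<in> V")
  have fin: "finite (std V B)" using assms by (simp add: std_def)
  have "?p = 0"
  proof (rule ccontr)
    assume "?p \<noteq> 0"
    then have "lead ?p \<in> std V B" using lead_in_keys keys_sum_mon[OF fin] by blast
    then show False using a \<open>?p \<noteq> 0\<close> unfolding std_def by blast
  qed
  then show "\<forall>c\<in>std V B. a c = 0" using lookup_sum_mon[OF fin, of a] by (metis lookup_zero)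
qed

lemma std_span_mod:
  assumes V: "mp.subspace V" "V \<subseteq> poly_span B" and B: "finite B"
  shows "span_mod V (poly_span B) mon (std V B)"
  unfolding span_mod_def
proof
  fix f :: "'a mpoly" assume f: "f \<in> poly_span B"
  obtain g where g: "\<And>x. x \<in> B \<Longrightarrow> Poly_Mapping.keys (g x) \<subseteq> std V B"
        "\<And>x. x \<in> B \<Longrightarrow> mon x - g x \<in> V"
    using normal_form_mon[OF V B] by (metis Int_subset_iff)
  define h where "h = (\<Sum>x\<in>B. Const (Poly_Mapping.lookup f x) * g x)"
  have fin: "finite (std V B)" using B by (simp add: std_def)
  have "h \<in> poly_span (std V B)"
    unfolding h_def using g(1)
    by (intro mp.subspace_sum mp.subspace_scale subspace_poly_span) (simp add: poly_span_def)
  then have h: "h = (\<Sum>m\<in>std V B. Const (Poly_Mapping.lookup h m) * mon m)"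
    by (intro mpoly_eq_sum[OF fin]) (simp add: poly_span_def)
  have "f - h = (\<Sum>x\<in>B. Const (Poly_Mapping.lookup f x) * (mon x - g x))"
    using f by (subst mpoly_eq_sum[OF B, of f])
      (simp_all add: poly_span_def h_def right_diff_distrib sum_subtractf)
  also have "\<dots> \<in> V" by (intro mp.subspace_sum[OF V(1)] mp.subspace_scale[OF V(1)] g)
  finally show "\<exists>a. f - (\<Sum>c\<in>std V B. Const (a c) * mon c) \<in> V" using h by metis
qed

text \<open>Standard monomials of \<open>W\<close> are standard for \<open>V\<close>, so the count
  makes both sets equal. An element of \<open>W\<close> reduces modulo \<open>V\<close> to a
  combination of them that lies in \<open>W\<close> and therefore vanishes.\<close>

lemma subspace_eq_of_card_std:
  assumes V: "mp.subspace V" "V \<subseteq> W" and W: "mp.subspace W" "W \<subseteq> poly_span B" and B: "finite B"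
    and card: "card (std V B) \<le> card (std W B)"
  shows "V = W"
proof
  have "std W B \<subseteq> std V B" using V(2) by (auto simp: std_def)
  then have eq: "std W B = std V B" using card B by (intro card_seteq) (auto simp: std_def)
  show "W \<subseteq> V"
  proof
    fix f assume f: "f \<in> W"
    obtain a where a: "f - (\<Sum>m\<in>std V B. Const (a m) * mon m) \<in> V"
      using std_span_mod[OF V(1) order_trans[OF V(2) W(2)] B] f W(2) unfolding span_mod_def by blast
    have "f - (f - (\<Sum>m\<in>std V B. Const (a m) * mon m)) \<in> W"
      by (rule mp.subspace_diff[OF W(1) f subsetD[OF V(2) a]])
    then have "(\<Sum>m\<in>std W B. Const (a m) * mon m) \<in> W" by (simp add: eq)
    then have "a m = 0" if "m \<in> std V B" for m
      using indep_modD[OF std_indep_mod[OF B], of a W m] that by (simp add: eq)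
    then have "(\<Sum>m\<in>std V B. Const (a m) * mon m) = 0" by simp
    then show "f \<in> V" using a by simp
  qed
qed (rule V(2))

section \<open>Counting monomials\<close>

definition monomials :: "nat set \<Rightarrow> nat \<Rightarrow> (nat \<Rightarrow>\<^sub>0 nat) set"
  where "monomials A s = {m. Poly_Mapping.keys m \<subseteq> A \<and> mono_degree m = s}"

lemma monomials_0: "monomials A 0 = {0}"
  by (auto simp: monomials_def mono_degree_eq_0_iff)

lemma monomials_empty: "monomials {} (Suc s) = {}"
  by (auto simp: monomials_def mono_degree_def)

lemma monomials_insert:
  assumes "a \<notin> A"
  shows "monomials (insert a A) (Suc s) = monomials A (Suc s) \<union> (\<lambda>m. m + xm a) ` monomials (insert a A) s"
    and "monomials A (Suc s) \<inter> (\<lambda>m. m + xm a) ` monomials (insert a A) s = {}"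
proof -
  show "monomials A (Suc s) \<inter> (\<lambda>m. m + xm a) ` monomials (insert a A) s = {}"
    using assms by (auto simp: monomials_def keys_add_monomial)
  have "m \<in> monomials A (Suc s) \<union> (\<lambda>m. m + xm a) ` monomials (insert a A) s"
    if m: "m \<in> monomials (insert a A) (Suc s)" for m
  proof (cases "a \<in> Poly_Mapping.keys m")
    case True
    then obtain u where "m = u + xm a" by (auto simp: in_keys_iff intro: split_xm)
    then show ?thesis
      using m by (auto simp: monomials_def keys_add_monomial mono_degree_add mono_degree_single)
  qed (use m in \<open>auto simp: monomials_def\<close>)
  then show "monomials (insert a A) (Suc s) = monomials A (Suc s) \<union> (\<lambda>m. m + xm a) ` monomials (insert a A) s"
    by (auto simp: monomials_def keys_add_monomial mono_degree_add mono_degree_single)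
qed

lemma finite_monomials: "finite A \<Longrightarrow> finite (monomials A s)"
proof (induction A arbitrary: s rule: finite_induct)
  case empty
  show ?case by (cases s) (simp_all add: monomials_0 monomials_empty)
next
  case (insert a A)
  show ?case by (induction s) (simp_all add: monomials_0 monomials_insert[OF insert.hyps(2)] insert.IH)
qed

lemma card_monomials: "finite A \<Longrightarrow> card A = Suc v \<Longrightarrow> card (monomials A s) = (v + s) choose s"
proof (induction A arbitrary: s v rule: finite_induct)
  case (insert a A)
  note ins = monomials_insert[OF insert.hyps(2)]
  have fin: "finite (monomials A s)" "finite (monomials (insert a A) s)" for s
    using insert.hyps by (simp_all add: finite_monomials)
  have step: "card (monomials (insert a A) (Suc s)) = card (monomials A (Suc s)) + card (monomials (insert a A) s)" for s
  proof -
    have "card (monomials A (Suc s) \<union> (\<lambda>m. m + xm a) ` monomials (insert a A) s) =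
        card (monomials A (Suc s)) + card ((\<lambda>m. m + xm a) ` monomials (insert a A) s)"
      by (rule card_Un_disjoint) (use fin ins in auto)
    moreover have "card ((\<lambda>m. m + xm a) ` monomials (insert a A) s) = card (monomials (insert a A) s)"
      by (rule card_image) (simp add: inj_on_def)
    ultimately show ?thesis unfolding ins(1) by simp
  qed
  show ?case
  proof (induction s)
    case (Suc s)
    show ?case
    proof (cases v)
      case 0
      then have "A = {}" using insert by simp
      then show ?thesis using Suc 0 step[of s] by (simp add: monomials_empty)
    next
      case (Suc v')
      then have "card (monomials A (Suc s)) = (v' + Suc s) choose Suc s"
        using insert by (intro insert.IH) simp
      then show ?thesis using step[of s] \<open>card (monomials (insert a A) s) = _\<close> Suc by simp
    qed
  qed (simp add: monomials_0)
qed simp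

lemma forms_eq: "forms n s = poly_span (monomials {..n} s)"
  by (auto simp: forms_def coord_ring_def poly_span_def monomials_def)

text \<open>If \<open>u\<close> were the lead of \<open>f\<close>, then \<open>u + xm k\<close>
  would be the lead of \<open>var_poly k * f\<close>.\<close>

lemma shadow_std:
  fixes V :: "nat \<Rightarrow> 'k::field mpoly set"
  assumes mult: "\<And>i f. i \<le> n \<Longrightarrow> f \<in> V s \<Longrightarrow> var_poly i * f \<in> V (Suc s)"
  shows "shadow (std (V (Suc s)) (monomials {..n} (Suc s))) \<subseteq> std (V s) (monomials {..n} s)"
proof
  fix u assume "u \<in> shadow (std (V (Suc s)) (monomials {..n} (Suc s)))"
  then obtain k where k: "u + xm k \<in> std (V (Suc s)) (monomials {..n} (Suc s))"
    by (auto simp: shadow_def)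
  then have u: "u \<in> monomials {..n} s" and kn: "k \<le> n"
    by (auto simp: std_def monomials_def keys_add_monomial mono_degree_add mono_degree_single)
  have "lead f \<noteq> u" if f: "f \<in> V s" "f \<noteq> 0" for f
  proof
    assume "lead f = u"
    then have "lead (var_poly k * f) = u + xm k"
      using lead_mon_mult[OF f(2), of "xm k"] by (simp add: var_poly_def add.commute)
    moreover have "var_poly k * f \<noteq> 0"
      using f(2) keys_mon_mult[of "xm k" f] by (auto simp: var_poly_def simp flip: keys_eq_empty)
    ultimately show False using k mult[OF kn f(1)] by (auto simp: std_def)
  qed
  then show "u \<in> std (V s) (monomials {..n} s)" using u by (simp add: std_def)
qed

lemma finite_std: "finite (std V (monomials {..n} s))"
  using finite_monomials[of "{..n}" s] by (simp add: std_def)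

text \<open>Stated for a family of sets linked by multiplication with the variables, since it will
  be applied to the hyperplane section, given degree by degree as
  \<open>I_s + L R_{s-1}\<close>.\<close>

lemma macaulay_std:
  fixes V :: "nat \<Rightarrow> 'k::field mpoly set"
  assumes "\<And>i f. i \<le> n \<Longrightarrow> f \<in> V s \<Longrightarrow> var_poly i * f \<in> V (Suc s)"
    and "1 \<le> l" "hyp_hf (Suc r) (Suc s) l \<le> card (std (V (Suc s)) (monomials {..n} (Suc s)))"
  shows "hyp_hf (Suc r) s l \<le> card (std (V s) (monomials {..n} s))"
proof -
  have "hyp_hf (Suc r) s l \<le> card (shadow (std (V (Suc s)) (monomials {..n} (Suc s))))"
    by (rule macaulay_shadow[OF finite_std]) (use assms in \<open>auto simp: std_def monomials_def\<close>)
  also have "\<dots> \<le> card (std (V s) (monomials {..n} s))"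
    using shadow_std[of n V s] assms(1) by (intro card_mono finite_std) auto
  finally show ?thesis .
qed

section \<open>The Hilbert function\<close>

lemma coord_ring_simps [simp]:
  "x \<otimes>\<^bsub>coord_ring n\<^esub> y = x * y" "x \<oplus>\<^bsub>coord_ring n\<^esub> y = x + y"
  "\<zero>\<^bsub>coord_ring n\<^esub> = 0" "\<one>\<^bsub>coord_ring n\<^esub> = 1"
  by (simp_all add: coord_ring_def)

lemma ring_coord_ring: "ring (coord_ring n :: 'k::field mpoly ring)"
  using coord_ring_cring by (rule cring.axioms)

lemma carrier_coord_ring: "carrier (coord_ring n) = poly_span {m. Poly_Mapping.keys m \<subseteq> {..n}}"
  by (auto simp: coord_ring_def poly_span_def)

lemma forms_subset_carrier: "forms n s \<subseteq> carrier (coord_ring n)"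
  by (auto simp: forms_def)

lemma carrier_mult:
  "p \<in> carrier (coord_ring n) \<Longrightarrow> q \<in> carrier (coord_ring n) \<Longrightarrow>
    p * q \<in> carrier (coord_ring n :: 'k::field mpoly ring)"
  using monoid.m_closed[OF ring.is_monoid[OF ring_coord_ring]] by (metis coord_ring_simps(1))

lemma subspace_carrier: "mp.subspace (carrier (coord_ring n :: 'k::field mpoly ring))"
  by (simp add: carrier_coord_ring subspace_poly_span)

lemma subspace_forms: "mp.subspace (forms n s)"
  by (simp add: forms_eq subspace_poly_span)

lemma minus_coord_ring:
  assumes "x \<in> carrier (coord_ring n :: 'k::field mpoly ring)" "y \<in> carrier (coord_ring n)"
  shows "x \<ominus>\<^bsub>coord_ring n\<^esub> y = x - y"
proof -
  interpret ring "coord_ring n :: 'k mpoly ring" by (rule ring_coord_ring)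
  have "- y \<in> carrier (coord_ring n)" by (rule mp.subspace_neg[OF subspace_carrier assms(2)])
  then have "\<ominus>\<^bsub>coord_ring n\<^esub> y = - y" using minus_equality[of "- y" y] assms(2) by simp
  then show ?thesis by (simp add: a_minus_def)
qed

lemma Const_carrier: "Const a \<in> carrier (coord_ring n)"
  by (simp add: carrier_coord_ring poly_span_def Const_def)

lemma var_poly_form: "i \<le> n \<Longrightarrow> var_poly i \<in> forms n 1"
  by (simp add: forms_eq poly_span_def var_poly_def monomials_def mono_degree_single)

lemma forms_mult:
  assumes "p \<in> forms n s" "q \<in> forms n t" shows "p * q \<in> forms n (s + t)"
proof -
  have "m \<in> monomials {..n} (s + t)" if m: "m \<in> Poly_Mapping.keys (p * q)" for m
  proof -
    obtain a b where ab: "m = a + b" "a \<in> Poly_Mapping.keys p" "b \<in> Poly_Mapping.keys q"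
      using m keys_mult[of p q] by blast
    then have "a \<in> monomials {..n} s" "b \<in> monomials {..n} t"
      using assms by (auto simp: forms_eq poly_span_def)
    then show ?thesis by (auto simp: ab(1) monomials_def keys_add_monomial mono_degree_add)
  qed
  then show ?thesis by (auto simp: forms_eq poly_span_def)
qed

lemma forms_var_mult: "i \<le> n \<Longrightarrow> f \<in> forms n s \<Longrightarrow> var_poly i * f \<in> forms n (Suc s)"
  using forms_mult[OF var_poly_form, of i n f s] by simp

lemma mon_form: "m \<in> monomials {..n} s \<Longrightarrow> mon m \<in> forms n s"
  by (simp add: forms_eq poly_span_def)

lemma ideal_mult:
  assumes "ideal I (coord_ring n :: 'k::field mpoly ring)" "f \<in> I" "c \<in> carrier (coord_ring n)"
  shows "c * f \<in> I"
  using ideal.I_l_closed[OF assms(1-3)] by simp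

lemma subspace_ideal:
  assumes I: "ideal I (coord_ring n :: 'k::field mpoly ring)" shows "mp.subspace I"
proof -
  interpret ideal I "coord_ring n :: 'k mpoly ring" by (rule I)
  show ?thesis
    unfolding mp.subspace_def
    using additive_subgroup.zero_closed[OF is_additive_subgroup]
      additive_subgroup.a_closed[OF is_additive_subgroup] ideal_mult[OF I _ Const_carrier]
    by simp
qed

lemma subspace_component:
  "ideal I (coord_ring n :: 'k::field mpoly ring) \<Longrightarrow> mp.subspace (component n I s)"
  unfolding component_def by (intro mp.subspace_inter subspace_ideal subspace_forms)

lemma component_subset: "component n I s \<subseteq> poly_span (monomials {..n} s)"
  by (auto simp: component_def forms_eq)

lemma component_var_mult:
  assumes "ideal I (coord_ring n :: 'k::field mpoly ring)" "i \<le> n" "f \<in> component n I s"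
  shows "var_poly i * f \<in> component n I (Suc s)"
  using assms ideal_mult[OF assms(1)] forms_var_mult var_poly_form forms_subset_carrier
  unfolding component_def by blast

lemma component_span_mod:
  assumes "ideal I (coord_ring n :: 'k::field mpoly ring)"
  shows "span_mod (component n I s) (forms n s) mon (std (component n I s) (monomials {..n} s))"
  unfolding forms_eq
  by (rule std_span_mod[OF subspace_component[OF assms] component_subset finite_monomials]) simp

lemma component_indep_mod:
  "indep_mod (component n I s) mon (std (component n I s) (monomials {..n} s))"
  by (rule std_indep_mod[OF finite_monomials]) simp

lemma sum_mon_form:
  assumes "N \<subseteq> monomials {..n} s"
  shows "(\<Sum>m\<in>N. Const (a m) * mon m) \<in> forms n s"
  using assms by (intro mp.subspace_sum mp.subspace_scale subspace_forms mon_form) auto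

lemma std_subset: "std V B \<subseteq> B"
  by (auto simp: std_def)

abbreviation hcount :: "nat \<Rightarrow> 'k::field mpoly set \<Rightarrow> nat \<Rightarrow> nat"
  where "hcount n V s \<equiv> card (std V (monomials {..n} s))"

section \<open>Dimensions in the quotient ring\<close>

lemma subfield_Const: "subfield (range Const) (coord_ring n :: 'k::field mpoly ring)"
proof -
  interpret cring "coord_ring n :: 'k mpoly ring" by (rule coord_ring_cring)
  have neg: "\<ominus>\<^bsub>coord_ring n\<^esub> Const a = - Const a" for a :: 'k
    by (rule minus_equality) (simp_all add: Const_carrier mp.subspace_neg[OF subspace_carrier])
  have sub: "subring (range Const) (coord_ring n :: 'k mpoly ring)"
  proof (rule subringI)
    show "range Const \<subseteq> carrier (coord_ring n :: 'k mpoly ring)" using Const_carrier by auto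
    show "\<one>\<^bsub>coord_ring n\<^esub> \<in> range (Const :: 'k \<Rightarrow> _)" by (auto intro!: image_eqI[of _ _ 1])
  qed (auto simp: neg simp flip: Const_add Const_mult Const_minus)
  have "inj (Const :: 'k \<Rightarrow> _)" by (rule injI) (metis Const_def lookup_single_eq)
  then have nz: "Const a \<noteq> (0 :: 'k mpoly)" if "a \<noteq> 0" for a :: 'k
    using that Const_0 by (metis injD)
  show ?thesis
  proof (rule subfieldI)
    show "subcring (range Const) (coord_ring n :: 'k mpoly ring)"
      by (rule subcringI'[OF sub])
    have "Const a \<in> Units (coord_ring n \<lparr>carrier := range Const\<rparr>)" if "a \<noteq> 0" for a :: 'k
      unfolding Units_def using that
      by (auto intro!: exI[of _ "inverse a"] simp flip: Const_mult)
    moreover have "0 \<notin> Units (coord_ring n \<lparr>carrier := range (Const :: 'k \<Rightarrow> _)\<rparr>)"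
      unfolding Units_def by auto
    ultimately show "Units (coord_ring n \<lparr>carrier := range (Const :: 'k \<Rightarrow> _)\<rparr>) = range Const - {\<zero>\<^bsub>coord_ring n\<^esub>}"
      by (auto simp: Units_def) (metis Const_0 rangeE)
  qed
qed

lemma dimension_poly_span:
  assumes "finite N" "N \<subseteq> {m. Poly_Mapping.keys m \<subseteq> {..n}}"
  shows "ring.dimension (coord_ring n) (card N) (range Const) (poly_span N :: 'k::field mpoly set)"
  using assms
proof (induction N rule: finite_induct)
  case empty
  interpret ring "coord_ring n :: 'k mpoly ring" by (rule ring_coord_ring)
  have "poly_span {} = {\<zero>\<^bsub>coord_ring n\<^esub> :: 'k mpoly}" by (auto simp: poly_span_def)
  then show ?case using zero_dim[of "range Const"] by (simp only: card.empty)
next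
  case (insert m N)
  interpret ring "coord_ring n :: 'k mpoly ring" by (rule ring_coord_ring)
  have "line_extension (range Const) (mon m) (poly_span N) = (poly_span (insert m N) :: 'k mpoly set)"
  proof (intro equalityI subsetI)
    fix p :: "'k mpoly" assume "p \<in> line_extension (range Const) (mon m) (poly_span N)"
    then obtain a v where "v \<in> poly_span N" "p = Const a * mon m + v"
      by (auto simp: line_extension_mem_iff)
    then show "p \<in> poly_span (insert m N)"
      using keys_add[of "Const a * mon m" v] by (auto simp: poly_span_def Const_mon split: if_splits)
  next
    fix p :: "'k mpoly" assume p: "p \<in> poly_span (insert m N)"
    define v where "v = p - Const (Poly_Mapping.lookup p m) * mon m"
    have "v \<in> poly_span N"
      using p unfolding poly_span_def v_def
      by (auto simp: in_keys_iff lookup_minus lookup_single when_def subset_iff split: if_splits)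
    moreover have "p = Const (Poly_Mapping.lookup p m) * mon m + v" by (simp add: v_def)
    ultimately show "p \<in> line_extension (range Const) (mon m) (poly_span N)"
      unfolding line_extension_mem_iff by auto
  qed
  moreover have "dimension (Suc (card N)) (range Const)
      (line_extension (range Const) (mon m) (poly_span N :: 'k mpoly set))"
    using insert by (intro Suc_dim) (auto simp: carrier_coord_ring poly_span_def)
  ultimately show ?case using insert.hyps by simp
qed

text \<open>The quotient map is injective on the span of the standard monomials and has the same
  image there as on all forms, so it transports the dimension. Properness keeps the image of the
  constants a field.\<close>

lemma hilbert_function_eq:
  assumes I: "ideal I (coord_ring n :: 'k::field mpoly ring)" and proper: "1 \<notin> I"
  shows "hilbert_function n I s = hcount n (component n I s) s"
proof -
  let ?R = "coord_ring n :: 'k mpoly ring" and ?N = "std (component n I s) (monomials {..n} s)"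
  let ?h = "(+>\<^bsub>?R\<^esub>) I"
  interpret h: ring_hom_ring ?R "?R Quot I" ?h by (rule ideal.rcos_ring_hom_ring[OF I])
  have fin: "finite ?N" by (rule finite_std)
  have same: "x - y \<in> I \<longleftrightarrow> ?h x = ?h y" if "x \<in> carrier ?R" "y \<in> carrier ?R" for x y
    using h.R.quotient_eq_iff_same_a_r_cos[OF I that] by (simp add: minus_coord_ring[OF that])
  have NR: "poly_span ?N \<subseteq> forms n s" by (auto simp: forms_eq poly_span_def std_def)
  have one: "\<one>\<^bsub>?R Quot I\<^esub> \<noteq> \<zero>\<^bsub>?R Quot I\<^esub>"
  proof
    assume "\<one>\<^bsub>?R Quot I\<^esub> = \<zero>\<^bsub>?R Quot I\<^esub>"
    then have "?h 1 = ?h 0" using h.hom_one h.hom_zero by simp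
    then show False using same[of 1 0] proper h.R.one_closed h.R.zero_closed by simp
  qed
  have "inj_on ?h (poly_span ?N)"
  proof (rule inj_onI)
    fix x y :: "'k mpoly" assume xy: "x \<in> poly_span ?N" "y \<in> poly_span ?N" "?h x = ?h y"
    then have "x - y \<in> I" using same[of x y] NR forms_subset_carrier by blast
    moreover have d: "x - y \<in> poly_span ?N" by (rule mp.subspace_diff[OF subspace_poly_span xy(1,2)])
    moreover have e: "x - y = (\<Sum>m\<in>?N. Const (Poly_Mapping.lookup (x - y) m) * mon m)"
      using d by (intro mpoly_eq_sum[OF fin]) (simp add: poly_span_def)
    ultimately have "(\<Sum>m\<in>?N. Const (Poly_Mapping.lookup (x - y) m) * mon m) \<in> component n I s"
      using NR by (auto simp: component_def)
    then have "Poly_Mapping.lookup (x - y) m = 0" if "m \<in> ?N" for m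
      using indep_modD[OF component_indep_mod _ that] by blast
    then show "x = y" using e by simp
  qed
  moreover have "h.R.dimension (card ?N) (range Const) (poly_span ?N)"
    by (rule dimension_poly_span[OF fin]) (auto simp: std_def monomials_def)
  ultimately have "h.S.dimension (card ?N) (?h ` range Const) (?h ` poly_span ?N)"
    by (rule h.inj_hom_dimension[OF subfield_Const one])
  moreover have "?h ` poly_span ?N = ?h ` forms n s"
  proof
    show "?h ` poly_span ?N \<subseteq> ?h ` forms n s" using NR by blast
    show "?h ` forms n s \<subseteq> ?h ` poly_span ?N"
    proof
      fix z assume "z \<in> ?h ` forms n s"
      then obtain f where f: "f \<in> forms n s" "z = ?h f" by blast
      then obtain a where a: "f - (\<Sum>m\<in>?N. Const (a m) * mon m) \<in> component n I s"
        using component_span_mod[OF I] unfolding span_mod_def by blast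
      let ?g = "\<Sum>m\<in>?N. Const (a m) * mon m"
      have g: "?g \<in> poly_span ?N" using keys_sum_mon[OF fin] by (auto simp: poly_span_def)
      then have "?h f = ?h ?g"
        using same[of f ?g] a f NR forms_subset_carrier unfolding component_def by blast
      then show "z \<in> ?h ` poly_span ?N" using g f(2) by blast
    qed
  qed
  moreover have "?h ` range Const = range (\<lambda>a. ?h (Const a))" by auto
  moreover have "subfield (?h ` range Const) (?R Quot I)"
    by (rule h.img_is_subfield(2)[OF subfield_Const one])
  ultimately show ?thesis
    unfolding hilbert_function_def using h.S.dimI by metis
qed

text \<open>In the zero ring the image of the constants is no field, so the value is read off from
  the inductive definition of dimension: there is no vector left to extend by.\<close>

lemma hilbert_function_unit:
  assumes I: "ideal I (coord_ring n :: 'k::field mpoly ring)" and "1 \<in> I"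
  shows "hilbert_function n I s = 0"
proof -
  let ?R = "coord_ring n :: 'k mpoly ring"
  let ?h = "(+>\<^bsub>?R\<^esub>) I"
  interpret h: ring_hom_ring ?R "?R Quot I" ?h by (rule ideal.rcos_ring_hom_ring[OF I])
  have IR: "I = carrier ?R" using ideal.one_imp_carrier[OF I] assms(2) by simp
  have z: "?h x = \<zero>\<^bsub>?R Quot I\<^esub>" if "x \<in> carrier ?R" for x
    using h.R.quotient_eq_iff_same_a_r_cos[OF I that h.R.zero_closed] that h.hom_zero
    unfolding minus_coord_ring[OF that h.R.zero_closed] by (simp add: IR)
  have car: "carrier (?R Quot I) = {\<zero>\<^bsub>?R Quot I\<^esub>}"
  proof -
    have "carrier (?R Quot I) = ?h ` carrier ?R"
      by (auto simp: FactRing_def A_RCOSETS_def')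
    then show ?thesis using z h.R.zero_closed by auto
  qed
  have E: "?h ` forms n s = {\<zero>\<^bsub>?R Quot I\<^esub>}"
  proof -
    have "?h ` forms n s \<subseteq> {\<zero>\<^bsub>?R Quot I\<^esub>}"
    proof (rule image_subsetI)
      fix x :: "'k mpoly" assume "x \<in> forms n s"
      then have "x \<in> carrier ?R" by (rule subsetD[OF forms_subset_carrier])
      then show "?h x \<in> {\<zero>\<^bsub>?R Quot I\<^esub>}" using z by simp
    qed
    moreover have "?h ` forms n s \<noteq> {}" using mp.subspace_0[OF subspace_forms, of n s] by auto
    ultimately show ?thesis by (metis subset_singletonD)
  qed
  have "m = 0 \<and> F = {\<zero>\<^bsub>?R Quot I\<^esub>}" if "h.S.dimension m K F" for m K F
    using that
  proof (induction rule: h.S.dimension.induct)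
    case (Suc_dim v E m K)
    then show ?case using car by auto
  qed simp
  then show ?thesis
    unfolding hilbert_function_def over_def E h.S.dim_def
    by (intro the_equality) auto
qed

section \<open>A linear form that is not a zero divisor\<close>

lemma std_mon_form: "m \<in> std V (monomials {..n} s) \<Longrightarrow> mon m \<in> forms n s"
  by (rule mon_form) (simp add: std_def)

text \<open>McCoy's argument for the polynomial \<open>\<Sum>\<^sub>i x\<^sub>i t\<^sup>i\<close> over \<open>R/I\<close>; \<open>F\<close> is the sequence of
  coefficients of the other factor.\<close>

lemma mccoy:
  fixes I :: "'k::field mpoly set"
  assumes I: "ideal I (coord_ring n)"
    and sat: "\<And>f. f \<in> carrier (coord_ring n) \<Longrightarrow> (\<And>i. i \<le> n \<Longrightarrow> var_poly i * f \<in> I) \<Longrightarrow> f \<in> I"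
    and F: "\<And>T. F T \<in> carrier (coord_ring n)" "\<And>T. N \<le> T \<Longrightarrow> F T \<in> I"
    and prod: "\<And>T. (\<Sum>i\<le>n. if i \<le> T then var_poly i * F (T - i) else 0) \<in> I"
  shows "F T \<in> I"
  using F prod
proof (induction N arbitrary: F T)
  case (Suc N)
  note sI = subspace_ideal[OF I]
  have var: "var_poly i \<in> carrier (coord_ring n :: 'k mpoly ring)" if "i \<le> n" for i
    using var_poly_form[OF that] forms_subset_carrier by blast
  have vF: "var_poly i * F U \<in> I" if "i \<le> n" "F U \<in> I" for i U
    using ideal_mult[OF I that(2) var[OF that(1)]] .
  have all: "\<forall>U. var_poly i * F U \<in> I" if "i \<le> n" for i
    using that
  proof (induction "n - i" arbitrary: i rule: less_induct)
    case (less i)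
    \<comment> \<open>In the coefficient of index \<open>i + N\<close>, terms with
      \<open>j < i\<close> involve \<open>F\<close> beyond index \<open>N\<close> and terms with
      \<open>j > i\<close> lie in \<open>I\<close> by the inner induction, which runs from
      \<open>i = n\<close> downwards. Only the term \<open>j = i\<close> remains.\<close>
    have top: "var_poly i * F N \<in> I"
    proof -
      let ?t = "\<lambda>j. if j \<le> i + N then var_poly j * F (i + N - j) else 0"
      have "?t j \<in> I" if j: "j \<in> {..n} - {i}" for j
      proof (cases "j < i")
        case True
        then have "F (i + N - j) \<in> I" by (intro Suc.prems(2)) simp
        then show ?thesis using vF[of j "i + N - j"] True less.prems by simp
      next
        case False
        then have "var_poly j * F U \<in> I" for U using less.hyps[of j] j less.prems by fastforce
        then show ?thesis using mp.subspace_0[OF sI] by simp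
      qed
      then have "(\<Sum>j\<in>{..n} - {i}. ?t j) \<in> I" by (intro mp.subspace_sum[OF sI])
      moreover have "(\<Sum>j\<le>n. ?t j) = ?t i + (\<Sum>j\<in>{..n} - {i}. ?t j)"
        using less.prems by (intro sum.remove) auto
      ultimately have "?t i \<in> I"
        using mp.subspace_diff[OF sI Suc.prems(3)[of "i + N"]] by fastforce
      then show ?thesis by simp
    qed
    \<comment> \<open>Multiplied by \<open>var_poly i\<close>, the sequence lies in \<open>I\<close>
      from index \<open>N\<close> on, one earlier than \<open>F\<close>, so the outer induction
      applies to it.\<close>
    have "var_poly i * F U \<in> I" for U
    proof (rule Suc.IH)
      show "var_poly i * F U \<in> carrier (coord_ring n)" for U
        by (rule carrier_mult[OF var[OF less.prems] Suc.prems(1)])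
      show "var_poly i * F U \<in> I" if "N \<le> U" for U
        using that top vF[OF less.prems Suc.prems(2)] by (cases "U = N") auto
      show "(\<Sum>j\<le>n. if j \<le> U then var_poly j * (var_poly i * F (U - j)) else 0) \<in> I" for U
      proof -
        have "(\<Sum>j\<le>n. if j \<le> U then var_poly j * (var_poly i * F (U - j)) else 0) =
          var_poly i * (\<Sum>j\<le>n. if j \<le> U then var_poly j * F (U - j) else 0)"
          unfolding sum_distrib_left by (rule sum.cong) (auto simp: ac_simps)
        then show ?thesis using ideal_mult[OF I Suc.prems(3) var[OF less.prems]] by simp
      qed
    qed
    then show ?case by blast
  qed
  show ?case by (rule sat[OF Suc.prems(1)]) (use all in blast)
qed simp

text \<open>Fraction-free Gaussian elimination over \<open>k[t]\<close>: vectors independent over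
  \<open>k[t]\<close> stay independent at every parameter where no pivot vanishes, and
  \<open>D\<close> is the product of the pivots.\<close>

lemma generic_independence:
  fixes w :: "'j \<Rightarrow> 'c \<Rightarrow> 'k::field poly"
  assumes "finite J"
  shows "(\<exists>f. (\<exists>j\<in>J. f j \<noteq> 0) \<and> (\<forall>c. (\<Sum>j\<in>J. f j * w j c) = 0)) \<or>
    (\<exists>D. D \<noteq> 0 \<and> (\<forall>t. poly D t \<noteq> 0 \<longrightarrow>
      (\<forall>a. (\<forall>c. (\<Sum>j\<in>J. a j * poly (w j c) t) = 0) \<longrightarrow> (\<forall>j\<in>J. a j = 0))))"
  using assms
proof (induction J arbitrary: w rule: finite_induct)
  case empty
  show ?case by (intro disjI2 exI[of _ 1]) simp
next
  case (insert x J)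
  show ?case
  proof (cases "\<forall>c. w x c = 0")
    case True
    have "(\<Sum>j\<in>insert x J. (if j = x then 1 else 0) * w j c) = 0" for c
      using insert.hyps True by (intro sum.neutral) auto
    then show ?thesis by (intro disjI1 exI[of _ "\<lambda>j. if j = x then 1 else 0"]) auto
  next
    case False
    then obtain c0 where c0: "w x c0 \<noteq> 0" by blast
    \<comment> \<open>Clears coordinate \<open>c0\<close> with the pivot \<open>w x c0\<close>,
      without division.\<close>
    define w' where "w' j c = w x c0 * w j c - w j c0 * w x c" for j c
    show ?thesis
      using insert.IH[of w']
    proof (elim disjE exE conjE)
      fix f assume f: "\<exists>j\<in>J. f j \<noteq> 0" "\<forall>c. (\<Sum>j\<in>J. f j * w' j c) = 0"
      \<comment> \<open>The coefficient at \<open>x\<close> is what turns a relation among the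
        \<open>w'\<close> into one among the \<open>w\<close>.\<close>
      define g where "g j = (if j = x then - (\<Sum>j\<in>J. f j * w j c0) else f j * w x c0)" for j
      have gJ: "g j = f j * w x c0" if "j \<in> J" for j
        using that insert.hyps by (auto simp: g_def)
      have "(\<Sum>j\<in>insert x J. g j * w j c) = 0" for c
      proof -
        have "(\<Sum>j\<in>insert x J. g j * w j c) =
            (\<Sum>j\<in>J. f j * w x c0 * w j c) - (\<Sum>j\<in>J. f j * w j c0) * w x c"
          using insert.hyps gJ by (simp add: g_def[of x])
        also have "\<dots> = (\<Sum>j\<in>J. f j * w' j c)"
          unfolding sum_distrib_right sum_subtractf[symmetric]
          by (rule sum.cong) (simp_all add: w'_def algebra_simps)
        finally show ?thesis using f(2) by simp
      qed
      moreover have "\<exists>j\<in>insert x J. g j \<noteq> 0" using f(1) gJ c0 by auto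
      ultimately show ?thesis by blast
    next
      fix D assume D: "D \<noteq> 0" "\<forall>t. poly D t \<noteq> 0 \<longrightarrow>
        (\<forall>a. (\<forall>c. (\<Sum>j\<in>J. a j * poly (w' j c) t) = 0) \<longrightarrow> (\<forall>j\<in>J. a j = 0))"
      have "\<forall>j\<in>insert x J. a j = 0"
        if t: "poly (D * w x c0) t \<noteq> 0"
          and a: "\<forall>c. (\<Sum>j\<in>insert x J. a j * poly (w j c) t) = 0" for t a
      proof -
        let ?w = "\<lambda>j c. poly (w j c) t"
        have a': "(\<Sum>j\<in>J. a j * ?w j c) = - (a x * ?w x c)" for c
          using a[rule_format, of c] insert.hyps by (simp add: add_eq_0_iff)
        have "(\<Sum>j\<in>J. a j * poly (w' j c) t) = 0" for c
        proof -
          have "(\<Sum>j\<in>J. a j * poly (w' j c) t) =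
              ?w x c0 * (\<Sum>j\<in>J. a j * ?w j c) - (\<Sum>j\<in>J. a j * ?w j c0) * ?w x c"
            unfolding sum_distrib_left sum_distrib_right sum_subtractf[symmetric]
            by (rule sum.cong) (simp_all add: w'_def algebra_simps)
          then show ?thesis unfolding a' by simp
        qed
        moreover have "poly D t \<noteq> 0" using t by simp
        ultimately have J0: "\<forall>j\<in>J. a j = 0" using D(2) by blast
        then have "a x * ?w x c0 = 0" using a'[of c0] by simp
        then show ?thesis using J0 t by auto
      qed
      moreover have "D * w x c0 \<noteq> 0" using D(1) c0 by simp
      ultimately show ?thesis by blast
    qed
  qed
qed

text \<open>The coefficients lie on the moment curve, so one parameter describes the forms and
  multiplication by them is polynomial in \<open>t\<close>.\<close>

definition lin_form :: "nat \<Rightarrow> 'k \<Rightarrow> 'k::field mpoly"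
  where "lin_form n t = (\<Sum>i\<le>n. Const (t ^ i) * var_poly i)"

lemma lin_form_form: "lin_form n t \<in> forms n 1"
  unfolding lin_form_def
  by (intro mp.subspace_sum mp.subspace_scale subspace_forms var_poly_form) simp

lemma Const_sum: "Const (sum h A) = (\<Sum>x\<in>A. Const (h x))"
  by (induction A rule: infinite_finite_induct) (simp_all add: Const_add)

text \<open>On standard monomials, multiplication by the sum of the \<open>t^i x_i\<close> is a
  matrix over \<open>k[t]\<close>. A relation among its rows is a polynomial in \<open>t\<close>
  over \<open>R/I\<close> annihilated by this factor, which \<open>mccoy\<close> excludes. Hence the
  rows stay independent outside the roots of some \<open>D\<close>, and multiplication is injective
  there.\<close>

lemma generic_lin_form_injective:
  fixes I :: "'k::field mpoly set"
  assumes I: "ideal I (coord_ring n)"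
    and sat: "\<And>f. f \<in> carrier (coord_ring n) \<Longrightarrow> (\<And>i. i \<le> n \<Longrightarrow> var_poly i * f \<in> I) \<Longrightarrow> f \<in> I"
  shows "\<exists>D. D \<noteq> 0 \<and> (\<forall>t. poly D t \<noteq> 0 \<longrightarrow> (\<forall>f\<in>forms n s. lin_form n t * f \<in> I \<longrightarrow> f \<in> I))"
proof -
  define J where "J = std (component n I s) (monomials {..n} s)"
  define N where "N = std (component n I (Suc s)) (monomials {..n} (Suc s))"
  note sI = subspace_ideal[OF I]
  have fin: "finite J" "finite N" by (simp_all add: J_def N_def finite_std)
  have J: "m \<in> monomials {..n} s" if "m \<in> J" for m using that by (auto simp: J_def std_def)
  have Jc: "mon m \<in> carrier (coord_ring n)" if "m \<in> J" for m
    using mon_form[OF J[OF that]] forms_subset_carrier by blast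
  have "\<forall>i m. \<exists>a. i \<le> n \<and> m \<in> J \<longrightarrow> var_poly i * mon m - (\<Sum>c\<in>N. Const (a c) * mon c) \<in> I"
    using component_span_mod[OF I, of "Suc s"] forms_var_mult mon_form[OF J]
    unfolding span_mod_def N_def component_def by blast
  then obtain a where a: "\<And>i m. i \<le> n \<Longrightarrow> m \<in> J \<Longrightarrow>
      var_poly i * mon m - (\<Sum>c\<in>N. Const (a i m c) * mon c) \<in> I"
    unfolding choice_iff by blast
  have Nform: "(\<Sum>c\<in>N. Const (b c) * mon c) \<in> forms n (Suc s)" for b
    by (rule sum_mon_form) (simp add: N_def std_subset)
  have Jform: "(\<Sum>m\<in>J. Const (b m) * mon m) \<in> forms n s" for b
    by (rule sum_mon_form) (simp add: J_def std_subset)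
  have Nindep: "b c = 0" if "(\<Sum>c\<in>N. Const (b c) * mon c) \<in> I" "c \<in> N" for b c
  proof (rule indep_modD[OF component_indep_mod[of n I "Suc s"]])
    show "(\<Sum>c\<in>std (component n I (Suc s)) (monomials {..n} (Suc s)). Const (b c) * mon c) \<in> component n I (Suc s)"
      using that(1) Nform[of b] unfolding N_def[symmetric] by (simp add: component_def)
  qed (use that in \<open>simp add: N_def\<close>)
  have Jindep: "b m = 0" if "(\<Sum>m\<in>J. Const (b m) * mon m) \<in> I" "m \<in> J" for b m
  proof (rule indep_modD[OF component_indep_mod[of n I s]])
    show "(\<Sum>c\<in>std (component n I s) (monomials {..n} s). Const (b c) * mon c) \<in> component n I s"
      using that(1) Jform[of b] unfolding J_def[symmetric] by (simp add: component_def)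
  qed (use that in \<open>simp add: J_def\<close>)
  \<comment> \<open>Rewrites products in the basis of degree \<open>s + 1\<close>. It is used with
    the \<open>t\<close>-coefficients of a supposed relation and with
    \<open>b m * t ^ i\<close>.\<close>
  have red: "(\<Sum>m\<in>J. \<Sum>i\<le>n. Const (e m i) * (var_poly i * mon m)) -
      (\<Sum>c\<in>N. Const (\<Sum>m\<in>J. \<Sum>i\<le>n. e m i * a i m c) * mon c) \<in> I" for e
  proof -
    have "(\<Sum>c\<in>N. Const (\<Sum>m\<in>J. \<Sum>i\<le>n. e m i * a i m c) * mon c) =
        (\<Sum>c\<in>N. \<Sum>m\<in>J. \<Sum>i\<le>n. Const (e m i) * (Const (a i m c) * mon c))"
      by (simp only: Const_sum sum_distrib_right Const_mult mult.assoc)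
    also have "\<dots> = (\<Sum>m\<in>J. \<Sum>c\<in>N. \<Sum>i\<le>n. Const (e m i) * (Const (a i m c) * mon c))"
      by (rule sum.swap)
    also have "\<dots> = (\<Sum>m\<in>J. \<Sum>i\<le>n. Const (e m i) * (\<Sum>c\<in>N. Const (a i m c) * mon c))"
      unfolding sum_distrib_left by (intro sum.cong refl sum.swap)
    finally have "(\<Sum>m\<in>J. \<Sum>i\<le>n. Const (e m i) * (var_poly i * mon m)) -
      (\<Sum>c\<in>N. Const (\<Sum>m\<in>J. \<Sum>i\<le>n. e m i * a i m c) * mon c) =
      (\<Sum>m\<in>J. \<Sum>i\<le>n. Const (e m i) *
        (var_poly i * mon m - (\<Sum>c\<in>N. Const (a i m c) * mon c)))"
      by (simp add: sum_subtractf right_diff_distrib)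
    also have "\<dots> \<in> I"
      using a by (intro mp.subspace_sum[OF sI] mp.subspace_scale[OF sI]) auto
    finally show ?thesis .
  qed
  \<comment> \<open>The value zero outside \<open>N\<close> makes the condition for all
    \<open>c\<close> in \<open>generic_independence\<close> the same as that for
    \<open>c \<in> N\<close>.\<close>
  define w where "w m c = (if c \<in> N then \<Sum>i\<le>n. monom (a i m c) i else 0)" for m c
  have "\<exists>D. D \<noteq> 0 \<and> (\<forall>t. poly D t \<noteq> 0 \<longrightarrow>
      (\<forall>b. (\<forall>c. (\<Sum>m\<in>J. b m * poly (w m c) t) = 0) \<longrightarrow> (\<forall>m\<in>J. b m = 0)))"
  proof -
    have False if f: "\<exists>m\<in>J. f m \<noteq> 0" "\<forall>c. (\<Sum>m\<in>J. f m * w m c) = 0" for f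
    proof -
      \<comment> \<open>The coefficient of \<open>t^T\<close> in the relation, read as a form of
        degree \<open>s\<close>.\<close>
      define F where "F T = (\<Sum>m\<in>J. Const (coeff (f m) T) * mon m)" for T
      define d where "d = Max ((\<lambda>m. degree (f m)) ` J)"
      have "F T \<in> I" for T
      proof (rule mccoy[where F = F and N = "Suc d", OF I])
        show "f \<in> I" if "f \<in> carrier (coord_ring n)" "\<And>i. i \<le> n \<Longrightarrow> var_poly i * f \<in> I" for f
          using that by (rule sat)
        show "F T \<in> carrier (coord_ring n)" for T
          unfolding F_def by (rule subsetD[OF forms_subset_carrier Jform])
        show "F T \<in> I" if "Suc d \<le> T" for T
        proof -
          have "coeff (f m) T = 0" if "m \<in> J" for m
          proof (rule coeff_eq_0)
            have "degree (f m) \<le> d" unfolding d_def using that fin by (intro Max_ge) auto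
            then show "degree (f m) < T" using \<open>Suc d \<le> T\<close> by simp
          qed
          then have "F T = 0" by (simp add: F_def)
          then show ?thesis using mp.subspace_0[OF sI] by simp
        qed
        show "(\<Sum>i\<le>n. if i \<le> T then var_poly i * F (T - i) else 0) \<in> I" for T
        proof -
          define e where "e m i = (if i \<le> T then coeff (f m) (T - i) else 0)" for m i
          have "(\<Sum>i\<le>n. if i \<le> T then var_poly i * F (T - i) else 0) =
              (\<Sum>i\<le>n. \<Sum>m\<in>J. Const (e m i) * (var_poly i * mon m))"
            by (rule sum.cong) (auto simp: F_def e_def sum_distrib_left ac_simps)
          also have "\<dots> = (\<Sum>m\<in>J. \<Sum>i\<le>n. Const (e m i) * (var_poly i * mon m))"
            by (rule sum.swap)
          finally have eq: "(\<Sum>i\<le>n. if i \<le> T then var_poly i * F (T - i) else 0) =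
              (\<Sum>m\<in>J. \<Sum>i\<le>n. Const (e m i) * (var_poly i * mon m))" .
          have "(\<Sum>m\<in>J. \<Sum>i\<le>n. e m i * a i m c) = 0" if "c \<in> N" for c
          proof -
            have "(\<Sum>m\<in>J. \<Sum>i\<le>n. e m i * a i m c) = coeff (\<Sum>m\<in>J. f m * w m c) T"
              unfolding coeff_sum w_def using that
              by (intro sum.cong refl)
                (auto simp: e_def sum_distrib_left coeff_sum coeff_monom_mult mult.commute[of _ "monom _ _"]
                  intro!: sum.cong)
            then show ?thesis using f(2) by simp
          qed
          then have "(\<Sum>c\<in>N. Const (\<Sum>m\<in>J. \<Sum>i\<le>n. e m i * a i m c) * mon c) = 0"
            by (intro sum.neutral) simp
          then show ?thesis using red[of e] by (simp add: eq)
        qed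
      qed
      then have "coeff (f m) T = 0" if "m \<in> J" for m T
        using Jindep[of "\<lambda>m. coeff (f m) T"] that by (simp add: F_def)
      then have "f m = 0" if "m \<in> J" for m using that by (simp add: poly_eq_iff)
      then show False using f(1) by blast
    qed
    then show ?thesis using generic_independence[OF fin(1), of w] by blast
  qed
  then obtain D where D: "D \<noteq> 0" "\<And>t b. poly D t \<noteq> 0 \<Longrightarrow>
      (\<And>c. (\<Sum>m\<in>J. b m * poly (w m c) t) = 0) \<Longrightarrow> \<forall>m\<in>J. b m = 0"
    by blast
  have "f \<in> I" if t: "poly D t \<noteq> 0" and f: "f \<in> forms n s" "lin_form n t * f \<in> I" for t f
  proof -
    obtain b where b: "f - (\<Sum>m\<in>J. Const (b m) * mon m) \<in> I"
      using component_span_mod[OF I, of s] f(1) unfolding span_mod_def J_def component_def by blast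
    let ?g = "\<Sum>m\<in>J. Const (b m) * mon m"
    have "lin_form n t * (f - ?g) \<in> I"
      using ideal_mult[OF I b] lin_form_form forms_subset_carrier by blast
    then have "lin_form n t * f - lin_form n t * (f - ?g) \<in> I" by (rule mp.subspace_diff[OF sI f(2)])
    then have Lg: "lin_form n t * ?g \<in> I" by (simp add: right_diff_distrib)
    have "lin_form n t * ?g = (\<Sum>m\<in>J. \<Sum>i\<le>n. Const (b m * t ^ i) * (var_poly i * mon m))"
      unfolding lin_form_def sum_distrib_left sum_distrib_right
      by (intro sum.cong refl) (simp add: Const_mult ac_simps)
    then have "(\<Sum>c\<in>N. Const (\<Sum>m\<in>J. \<Sum>i\<le>n. b m * t ^ i * a i m c) * mon c) \<in> I"
      using mp.subspace_diff[OF sI Lg red[of "\<lambda>m i. b m * t ^ i"]] by simp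
    then have N0: "(\<Sum>m\<in>J. \<Sum>i\<le>n. b m * t ^ i * a i m c) = 0" if "c \<in> N" for c
      by (rule Nindep[OF _ that])
    have "(\<Sum>m\<in>J. b m * poly (w m c) t) = 0" for c
    proof (cases "c \<in> N")
      case True
      then have "(\<Sum>m\<in>J. b m * poly (w m c) t) = (\<Sum>m\<in>J. \<Sum>i\<le>n. b m * t ^ i * a i m c)"
        by (simp add: w_def poly_sum poly_monom sum_distrib_left ac_simps)
      then show ?thesis using N0[OF True] by simp
    qed (simp add: w_def)
    then have "\<forall>m\<in>J. b m = 0" using D(2)[OF t] by blast
    then have "?g = 0" by simp
    then show ?thesis using b by simp
  qed
  then show ?thesis using D(1) by blast
qed

text \<open>Each degree below \<open>d\<close> excludes the roots of one nonzero polynomial; in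
  characteristic zero the field is infinite, so their product has a non-root.\<close>

lemma exists_lin_form_injective:
  fixes I :: "'k::{field, ring_char_0} mpoly set"
  assumes "ideal I (coord_ring n)"
    and "\<And>f. f \<in> carrier (coord_ring n) \<Longrightarrow> (\<And>i. i \<le> n \<Longrightarrow> var_poly i * f \<in> I) \<Longrightarrow> f \<in> I"
  obtains L where "L \<in> forms n 1" "\<And>s f. s < d \<Longrightarrow> f \<in> forms n s \<Longrightarrow> L * f \<in> I \<Longrightarrow> f \<in> I"
proof -
  obtain D where D: "\<And>s. D s \<noteq> 0"
    "\<And>s t f. poly (D s) t \<noteq> 0 \<Longrightarrow> f \<in> forms n s \<Longrightarrow> lin_form n t * f \<in> I \<Longrightarrow> f \<in> I"
    using generic_lin_form_injective[OF assms] by metis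
  have "(\<Prod>s<d. D s) \<noteq> 0" using D(1) by simp
  then obtain t where "poly (\<Prod>s<d. D s) t \<noteq> 0" using poly_all_0_iff_0 by blast
  then have "poly (D s) t \<noteq> 0" if "s < d" for s
    using that by (simp add: poly_prod)
  then show ?thesis using that[OF lin_form_form] D(2) by blast
qed

text \<open>Exactness of \<open>0 -> (R/I)_s -> (R/I)_{s+1} -> R_{s+1}/W -> 0\<close>, whose first
  map is multiplication by \<open>L\<close>. The \<open>L\<close>-multiples of the standard
  monomials of \<open>I\<close> in degree \<open>s\<close>, together with the standard monomials of
  \<open>W\<close>, form a basis modulo \<open>I\<close>.\<close>

lemma card_std_hyperplane_section:
  fixes I :: "'k::field mpoly set"
  assumes I: "ideal I (coord_ring n)" and L: "L \<in> forms n 1"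
    and inj: "\<And>f. f \<in> forms n s \<Longrightarrow> L * f \<in> I \<Longrightarrow> f \<in> I"
    and W: "W = {g + L * f | g f. g \<in> component n I (Suc s) \<and> f \<in> forms n s}"
  shows "mp.subspace W" "W \<subseteq> forms n (Suc s)"
    "hcount n (component n I (Suc s)) (Suc s) = hcount n (component n I s) s + hcount n W (Suc s)"
proof -
  let ?A = "std (component n I s) (monomials {..n} s)"
  let ?B = "std W (monomials {..n} (Suc s))"
  let ?C = "std (component n I (Suc s)) (monomials {..n} (Suc s))"
  have Lf: "L * f \<in> forms n (Suc s)" if "f \<in> forms n s" for f
    using forms_mult[OF L that] by simp
  have LI: "L * f \<in> component n I (Suc s)" if "f \<in> component n I s" for f
    using that Lf ideal_mult[OF I] L forms_subset_carrier unfolding component_def by blast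
  note sC = subspace_component[OF I, of "Suc s"]
  have WI: "g + L * f \<in> W" if "g \<in> component n I (Suc s)" "f \<in> forms n s" for g f
    unfolding W using that by blast
  show sW: "mp.subspace W"
    unfolding mp.subspace_def
  proof (intro conjI ballI allI)
    show "0 \<in> W"
      unfolding W using mp.subspace_0[OF sC] mp.subspace_0[OF subspace_forms, of n s]
      by (auto intro!: exI[of _ 0])
  next
    fix x y assume "x \<in> W" "y \<in> W"
    then obtain g f g' f' where gf: "x = g + L * f" "y = g' + L * f'"
      "g \<in> component n I (Suc s)" "g' \<in> component n I (Suc s)" "f \<in> forms n s" "f' \<in> forms n s"
      unfolding W by blast
    then have "x + y = (g + g') + L * (f + f')" by (simp add: distrib_left ac_simps)
    then show "x + y \<in> W"
      unfolding W using mp.subspace_add[OF sC gf(3,4)] mp.subspace_add[OF subspace_forms gf(5,6)]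
      by blast
  next
    fix c x assume "x \<in> W"
    then obtain g f where gf: "x = g + L * f" "g \<in> component n I (Suc s)" "f \<in> forms n s"
      unfolding W by blast
    then have "Const c * x = Const c * g + L * (Const c * f)" by (simp add: distrib_left ac_simps)
    then show "Const c * x \<in> W"
      unfolding W using mp.subspace_scale[OF sC gf(2)] mp.subspace_scale[OF subspace_forms gf(3)]
      by blast
  qed
  show WF: "W \<subseteq> forms n (Suc s)"
    unfolding W component_def using mp.subspace_add[OF subspace_forms] Lf by blast
  have CW: "component n I (Suc s) \<subseteq> W"
    unfolding W using mp.subspace_0[OF subspace_forms, of n s] by force
  have fin: "finite ?A" "finite ?B" "finite ?C" by (rule finite_std)+
  define g :: "((nat \<Rightarrow>\<^sub>0 nat) + (nat \<Rightarrow>\<^sub>0 nat)) \<Rightarrow> 'k mpoly"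
    where "g = case_sum (\<lambda>m. L * mon m) mon"
  have split: "(\<Sum>c\<in>?A <+> ?B. Const (a c) * g c) =
      L * (\<Sum>m\<in>?A. Const (a (Inl m)) * mon m) + (\<Sum>m\<in>?B. Const (a (Inr m)) * mon m)" for a
    using fin by (simp add: sum.Plus g_def sum_distrib_left ac_simps)
  have Aform: "(\<Sum>m\<in>?A. Const (b m) * mon m) \<in> forms n s" for b
    by (rule sum_mon_form) (rule std_subset)
  have Bform: "(\<Sum>m\<in>?B. Const (b m) * mon m) \<in> forms n (Suc s)" for b
    by (rule sum_mon_form) (rule std_subset)
  have "indep_mod (component n I (Suc s)) g (?A <+> ?B)"
    unfolding indep_mod_def split
  proof (intro allI impI)
    fix a assume a: "L * (\<Sum>m\<in>?A. Const (a (Inl m)) * mon m) +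
      (\<Sum>m\<in>?B. Const (a (Inr m)) * mon m) \<in> component n I (Suc s)" (is "L * ?p + ?q \<in> _")
    have "(L * ?p + ?q) + L * (- ?p) \<in> W"
      by (rule WI[OF a mp.subspace_neg[OF subspace_forms Aform]])
    moreover have "(L * ?p + ?q) + L * (- ?p) = ?q" by simp
    ultimately have "?q \<in> W" by (simp only:)
    then have B: "\<forall>m\<in>?B. a (Inr m) = 0"
      using indep_modD[OF std_indep_mod[OF finite_monomials[of "{..n}"]], of "\<lambda>m. a (Inr m)"] by simp
    then have "?q = 0" by simp
    then have "L * ?p \<in> I" using a by (simp add: component_def)
    then have "?p \<in> component n I s" using inj[OF Aform] Aform by (simp add: component_def)
    then have "\<forall>m\<in>?A. a (Inl m) = 0"
      using indep_modD[OF component_indep_mod, of "\<lambda>m. a (Inl m)"] by simp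
    then show "\<forall>c\<in>?A <+> ?B. a c = 0" using B by auto
  qed
  moreover have "span_mod (component n I (Suc s)) (forms n (Suc s)) g (?A <+> ?B)"
    unfolding span_mod_def
  proof
    fix h :: "'k mpoly" assume h: "h \<in> forms n (Suc s)"
    have "span_mod W (forms n (Suc s)) mon ?B"
      using std_span_mod[OF sW _ finite_monomials] WF by (simp add: forms_eq)
    then obtain b where "h - (\<Sum>m\<in>?B. Const (b m) * mon m) \<in> W"
      using h unfolding span_mod_def by blast
    then obtain p f where pf: "p \<in> component n I (Suc s)" "f \<in> forms n s"
        "h - (\<Sum>m\<in>?B. Const (b m) * mon m) = p + L * f"
      unfolding W by blast
    obtain a where a: "f - (\<Sum>m\<in>?A. Const (a m) * mon m) \<in> component n I s"
      using component_span_mod[OF I] pf(2) unfolding span_mod_def by blast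
    have "h - (L * (\<Sum>m\<in>?A. Const (a m) * mon m) + (\<Sum>m\<in>?B. Const (b m) * mon m)) =
        p + L * (f - (\<Sum>m\<in>?A. Const (a m) * mon m))"
      using pf(3) by (simp add: algebra_simps)
    also have "\<dots> \<in> component n I (Suc s)" by (rule mp.subspace_add[OF sC pf(1) LI[OF a]])
    finally show "\<exists>a. h - (\<Sum>c\<in>?A <+> ?B. Const (a c) * g c) \<in> component n I (Suc s)"
      unfolding split by (intro exI[of _ "case_sum a b"]) simp
  qed
  moreover have "g c \<in> forms n (Suc s)" if "c \<in> ?A <+> ?B" for c
    using that Lf[OF std_mon_form] std_mon_form by (auto simp: g_def)
  moreover have "mon c \<in> forms n (Suc s)" if "c \<in> ?C" for c
    using that by (rule std_mon_form)
  ultimately have "card ?C = card (?A <+> ?B)"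
    using fin component_span_mod[OF I, of "Suc s"] component_indep_mod[of n I "Suc s"]
    by (intro antisym card_indep_mod_le[OF sC, where E = "forms n (Suc s)"]) auto
  then show "card ?C = card ?A + card ?B" using fin by (simp add: card_Plus)
qed

section \<open>The linear forms and the hypersurface\<close>

definition subst_mon :: "(nat \<Rightarrow> 'k::field mpoly) \<Rightarrow> (nat \<Rightarrow>\<^sub>0 nat) \<Rightarrow> 'k mpoly"
  where "subst_mon \<phi> m = (\<Prod>i\<in>Poly_Mapping.keys m. \<phi> i ^ Poly_Mapping.lookup m i)"

definition subst :: "(nat \<Rightarrow> 'k::field mpoly) \<Rightarrow> 'k mpoly \<Rightarrow> 'k mpoly"
  where "subst \<phi> p = (\<Sum>m\<in>Poly_Mapping.keys p. Const (Poly_Mapping.lookup p m) * subst_mon \<phi> m)"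

lemma subst_mon_superset:
  assumes "finite A" "Poly_Mapping.keys m \<subseteq> A"
  shows "subst_mon \<phi> m = (\<Prod>i\<in>A. \<phi> i ^ Poly_Mapping.lookup m i)"
  unfolding subst_mon_def using assms by (intro prod.mono_neutral_left) (auto simp: in_keys_iff)

lemma subst_mon_add: "subst_mon \<phi> (a + b) = subst_mon \<phi> a * subst_mon \<phi> b"
proof -
  let ?A = "Poly_Mapping.keys a \<union> Poly_Mapping.keys b"
  have "subst_mon \<phi> (a + b) = (\<Prod>i\<in>?A. \<phi> i ^ Poly_Mapping.lookup (a + b) i)"
    by (rule subst_mon_superset) (auto simp: keys_add_monomial)
  then show ?thesis
    by (simp add: subst_mon_superset[of ?A] lookup_add power_add prod.distrib)
qed

lemma subst_superset:
  assumes "finite A" "Poly_Mapping.keys p \<subseteq> A"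
  shows "subst \<phi> p = (\<Sum>m\<in>A. Const (Poly_Mapping.lookup p m) * subst_mon \<phi> m)"
  unfolding subst_def using assms by (intro sum.mono_neutral_left) (auto simp: in_keys_iff)

lemma subst_add: "subst \<phi> (p + q) = subst \<phi> p + subst \<phi> q"
proof -
  let ?A = "Poly_Mapping.keys p \<union> Poly_Mapping.keys q"
  have "subst \<phi> (p + q) = (\<Sum>m\<in>?A. Const (Poly_Mapping.lookup (p + q) m) * subst_mon \<phi> m)"
    by (rule subst_superset) (auto dest: subsetD[OF Poly_Mapping.keys_add])
  then show ?thesis
    by (simp add: subst_superset[of ?A] lookup_add Const_add distrib_right sum.distrib)
qed

lemma subst_0 [simp]: "subst \<phi> 0 = 0"
  by (simp add: subst_def)

lemma subst_uminus: "subst \<phi> (- p) = - subst \<phi> p"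
  by (simp add: subst_def Const_minus sum_negf)

lemma subst_sum: "subst \<phi> (sum f A) = (\<Sum>x\<in>A. subst \<phi> (f x))"
  by (induction A rule: infinite_finite_induct) (simp_all add: subst_add)

lemma subst_single: "subst \<phi> (Poly_Mapping.single m c) = Const c * subst_mon \<phi> m"
  by (simp add: subst_def)

lemma subst_mult: "subst \<phi> (p * q) = subst \<phi> p * subst \<phi> (q :: 'k::field mpoly)"
proof -
  let ?P = "Poly_Mapping.keys p" and ?Q = "Poly_Mapping.keys q"
  let ?p = "Poly_Mapping.lookup p" and ?q = "Poly_Mapping.lookup q"
  have "p * q = (\<Sum>a\<in>?P. Poly_Mapping.single a (?p a)) * (\<Sum>b\<in>?Q. Poly_Mapping.single b (?q b))"
    using mpoly_eq_sum[of ?P p] mpoly_eq_sum[of ?Q q] by (simp add: Const_mon)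
  also have "\<dots> = (\<Sum>a\<in>?P. \<Sum>b\<in>?Q. Poly_Mapping.single (a + b) (?p a * ?q b))"
    by (simp add: sum_product mult_single)
  finally have "subst \<phi> (p * q) =
      (\<Sum>a\<in>?P. \<Sum>b\<in>?Q. (Const (?p a) * subst_mon \<phi> a) * (Const (?q b) * subst_mon \<phi> b))"
    by (simp add: subst_sum subst_single subst_mon_add Const_mult ac_simps)
  then show ?thesis by (simp add: subst_def sum_product)
qed

lemma subst_mon_var:
  assumes "\<And>i. i \<in> Poly_Mapping.keys m \<Longrightarrow> \<phi> i = var_poly i"
  shows "subst_mon \<phi> m = (mon m :: 'k::field mpoly)"
proof -
  have pw: "(var_poly i :: 'k mpoly) ^ e = mon (Poly_Mapping.single i e)" for i e
    by (induction e) (simp_all add: var_poly_def mult_single single_add[symmetric])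
  have pr: "(\<Prod>i\<in>K. mon (h i)) = (mon (\<Sum>i\<in>K. h i) :: 'k mpoly)" if "finite K"
    for K :: "nat set" and h
    using that by (induction K rule: finite_induct) (simp_all add: mult_single)
  have "(\<Sum>i\<in>Poly_Mapping.keys m. Poly_Mapping.single i (Poly_Mapping.lookup m i)) = m"
    by (rule poly_mapping_eqI) (auto simp: lookup_sum lookup_single when_def in_keys_iff sum.delta')
  then show ?thesis
    unfolding subst_mon_def using assms by (simp add: pw pr)
qed

lemma subst_id:
  assumes "\<And>m i. m \<in> Poly_Mapping.keys p \<Longrightarrow> i \<in> Poly_Mapping.keys m \<Longrightarrow> \<phi> i = var_poly i"
  shows "subst \<phi> p = (p :: 'k::field mpoly)"
proof -
  have "subst \<phi> p = (\<Sum>m\<in>Poly_Mapping.keys p. Const (Poly_Mapping.lookup p m) * mon m)"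
    unfolding subst_def
  proof (rule sum.cong[OF refl])
    fix m assume "m \<in> Poly_Mapping.keys p"
    then have "subst_mon \<phi> m = mon m" using assms by (intro subst_mon_var) blast
    then show "Const (Poly_Mapping.lookup p m) * subst_mon \<phi> m =
        Const (Poly_Mapping.lookup p m) * mon m" by simp
  qed
  then show ?thesis using mpoly_eq_sum[of "Poly_Mapping.keys p" p] by simp
qed

text \<open>The kernel of a substitution is an ideal. This will show that a form lies outside the
  ideal of a linear subspace.\<close>

lemma subst_genideal:
  assumes S: "S \<subseteq> carrier (coord_ring n :: 'k::field mpoly ring)"
    and root: "\<And>p. p \<in> S \<Longrightarrow> subst \<phi> p = 0" and p: "p \<in> genideal (coord_ring n) S"
  shows "subst \<phi> p = 0"
proof -
  let ?R = "coord_ring n :: 'k mpoly ring" and ?Z = "{p \<in> carrier (coord_ring n). subst \<phi> p = 0}"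
  interpret cring ?R by (rule coord_ring_cring)
  have "ideal ?Z ?R"
  proof (rule idealI)
    show "subgroup ?Z (add_monoid ?R)"
    proof (rule subgroup.intro)
      show "inv\<^bsub>add_monoid ?R\<^esub> x \<in> ?Z" if "x \<in> ?Z" for x
      proof -
        have x: "x \<in> carrier ?R" using that by simp
        have "\<ominus>\<^bsub>?R\<^esub> x = - x"
          by (rule minus_equality) (simp_all add: x mp.subspace_neg[OF subspace_carrier])
        then show ?thesis
          using that mp.subspace_neg[OF subspace_carrier x] by (simp add: a_inv_def subst_uminus)
      qed
    qed (use a_closed zero_closed in \<open>auto simp: subst_add\<close>)
  qed (use m_closed in \<open>auto simp: subst_mult ring_axioms\<close>)
  then have "genideal ?R S \<subseteq> ?Z" by (rule genideal_minimal) (use S root in auto)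
  then show ?thesis using p by blast
qed

text \<open>Descent from degree \<open>e + 1\<close>: there \<open>diff\<close> bounds the
  hyperplane section from below, Macaulay's bound carries this to all lower positive degrees, and
  subtracting the sections one by one from \<open>top\<close> bounds \<open>I\<close> from
  above.\<close>

lemma hcount_le:
  fixes I :: "'k::{field, ring_char_0} mpoly set"
  assumes I: "ideal I (coord_ring n)"
    and sat: "\<And>f. f \<in> carrier (coord_ring n) \<Longrightarrow> (\<And>i. i \<le> n \<Longrightarrow> var_poly i * f \<in> I) \<Longrightarrow> f \<in> I"
    and l: "1 \<le> l"
    and top: "hcount n (component n I (Suc e)) (Suc e) \<le> hyp_hf (Suc (Suc r)) (Suc e) l"
    and diff: "hyp_hf (Suc r) (Suc e) l + hcount n (component n I e) e \<le>
      hcount n (component n I (Suc e)) (Suc e)"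
    and s: "s \<le> Suc e"
  shows "hcount n (component n I s) s \<le> hyp_hf (Suc (Suc r)) s l"
proof -
  obtain L where L: "L \<in> forms n 1"
    and inj: "\<And>s f. s < Suc e \<Longrightarrow> f \<in> forms n s \<Longrightarrow> L * f \<in> I \<Longrightarrow> f \<in> I"
    using exists_lin_form_injective[OF I sat, of "Suc e"] by blast
  \<comment> \<open>Because of the truncated subtraction, degree \<open>0\<close> has no sensible
    meaning; closure under the variables is claimed only from degree \<open>1\<close> on.\<close>
  define V where "V s = {g + L * f | g f. g \<in> component n I s \<and> f \<in> forms n (s - 1)}" for s
  have sec: "hcount n (component n I (Suc s)) (Suc s) =
      hcount n (component n I s) s + hcount n (V (Suc s)) (Suc s)" if "s \<le> e" for s
    by (rule card_std_hyperplane_section(3)[OF I L])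
      (use that inj[of s] in \<open>auto simp: V_def\<close>)
  have V: "var_poly i * f \<in> V (Suc s)" if il: "i \<le> n" and fV: "f \<in> V s" and s0: "s \<noteq> 0" for i f s
  proof -
    obtain g h where gh: "g \<in> component n I s" "h \<in> forms n (s - 1)" "f = g + L * h"
      using fV unfolding V_def by blast
    have "var_poly i * f = var_poly i * g + L * (var_poly i * h)"
      unfolding gh(3) by (simp add: algebra_simps)
    moreover have "var_poly i * h \<in> forms n (Suc s - 1)"
      using forms_var_mult[OF il gh(2)] s0 by simp
    ultimately show ?thesis
      unfolding V_def using component_var_mult[OF I il gh(1)] by blast
  qed
  have low: "hyp_hf (Suc r) (Suc s) l \<le> hcount n (V (Suc s)) (Suc s)" if "s \<le> e" for s
    using that
  proof (induction rule: inc_induct)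
    case base
    show ?case using diff sec[of e] by simp
  next
    case (step s)
    show ?case by (rule macaulay_std[where V = V, OF _ l step.IH]) (use V in auto)
  qed
  show ?thesis
    using s
  proof (induction rule: inc_induct)
    case base
    show ?case by (rule top)
  next
    case (step s)
    then show ?case using low[of s] sec[of s] hyp_hf_pascal[of "Suc r" s l] by simp
  qed
qed

section \<open>Counting standard monomials of a hypersurface\<close>

lemma hyp_hf_complement:
  assumes "l \<le> d"
  shows "hyp_hf (Suc r) d l + ((Suc r + (d - l)) choose (d - l)) = (Suc r + d) choose d"
proof -
  have e: "Suc d - l = Suc (d - l)" using assms by simp
  have "{..d} = {..d - l} \<union> {Suc (d - l)..d}" by auto
  then have "(\<Sum>j\<le>d. (r + j) choose j) =
      (\<Sum>j\<le>d - l. (r + j) choose j) + (\<Sum>j=Suc (d - l)..d. (r + j) choose j)"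
    by (simp only:) (rule sum.union_disjoint, auto)
  then show ?thesis
    using sum_choose_lower[of r d] sum_choose_lower[of r "d - l"] by (simp add: hyp_hf_def e)
qed

lemma lead_multiple_not_std:
  assumes H: "ideal H (coord_ring n :: 'k::field mpoly ring)"
    and f: "f \<in> H" "f \<in> forms n t" "f \<noteq> 0" and m: "u + lead f \<in> monomials {..n} d"
  shows "u + lead f \<notin> std (component n H d) (monomials {..n} d)"
proof -
  have "lead f \<in> monomials {..n} t"
    using lead_in_keys[OF f(3)] f(2) by (auto simp: forms_eq poly_span_def)
  then have u: "u \<in> monomials {..n} (mono_degree u)" "d = mono_degree u + t"
    using m by (auto simp: monomials_def keys_add_monomial mono_degree_add)
  have "mon u * f \<in> component n H d"
    using ideal_mult[OF H f(1)] mon_form[OF u(1)] forms_subset_carrier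
      forms_mult[OF mon_form[OF u(1)] f(2)] u(2)
    unfolding component_def by blast
  moreover have "mon u * f \<noteq> 0"
    using f(3) keys_mon_mult[of u f] by (auto simp flip: keys_eq_empty)
  moreover have "lead (mon u * f) = u + lead f" by (rule lead_mon_mult[OF f(3)])
  ultimately show ?thesis unfolding std_def by blast
qed

text \<open>The leads of the linear forms exclude every variable outside \<open>A\<close>, and the
  lead of \<open>F\<close> excludes its multiples. The remaining monomials are counted by
  \<open>hyp_hf_complement\<close>.\<close>

lemma hcount_hypersurface_le:
  assumes H: "ideal H (coord_ring n :: 'k::field mpoly ring)"
    and A: "A \<subseteq> {..n}" "card A = Suc (Suc r)" and l: "l \<le> d"
    and ell: "\<And>i. i \<in> {..n} - A \<Longrightarrow> \<exists>f. f \<in> H \<and> f \<in> forms n 1 \<and> f \<noteq> 0 \<and> lead f = xm i"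
    and F: "F \<in> H" "F \<noteq> 0" "Poly_Mapping.keys F \<subseteq> monomials A l"
  shows "hcount n (component n H d) d \<le> hyp_hf (Suc r) d l"
proof -
  let ?N = "std (component n H d) (monomials {..n} d)"
  let ?M = "(\<lambda>u. u + lead F) ` monomials A (d - l)"
  have finA: "finite A" using A(1) finite_subset by blast
  have mA: "monomials A t \<subseteq> monomials {..n} t" for t using A(1) by (auto simp: monomials_def)
  have lF: "lead F \<in> monomials A l" using lead_in_keys[OF F(2)] F(3) by blast
  have M: "?M \<subseteq> monomials A d"
    using lF l by (auto simp: monomials_def keys_add_monomial mono_degree_add)
  have "?N \<subseteq> monomials A d - ?M"
  proof
    fix m assume m: "m \<in> ?N"
    then have mB: "m \<in> monomials {..n} d" by (simp add: std_def)
    have "i \<in> A" if i: "i \<in> Poly_Mapping.keys m" for i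
    proof (rule ccontr)
      assume "i \<notin> A"
      moreover have "i \<le> n" using mB i by (auto simp: monomials_def)
      ultimately obtain f where f: "f \<in> H" "f \<in> forms n 1" "f \<noteq> 0" "lead f = xm i"
        using ell[of i] by auto
      obtain u where "m = u + xm i" using i by (auto simp: in_keys_iff intro: split_xm)
      then show False using lead_multiple_not_std[OF H f(1-3), of u d] f(4) m mB by simp
    qed
    then have "m \<in> monomials A d" using mB by (auto simp: monomials_def)
    moreover have "m \<notin> ?M"
    proof
      assume "m \<in> ?M"
      then obtain u where "m = u + lead F" by blast
      moreover have "F \<in> forms n l" using F(3) mA by (auto simp: forms_eq poly_span_def)
      ultimately show False using lead_multiple_not_std[OF H F(1) _ F(2), of l u d] m mB by simp
    qed
    ultimately show "m \<in> monomials A d - ?M" by blast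
  qed
  then have "card ?N \<le> card (monomials A d - ?M)"
    by (intro card_mono) (simp_all add: finite_monomials finA)
  also have "\<dots> = card (monomials A d) - card ?M"
    using M finite_monomials[OF finA] by (intro card_Diff_subset finite_imageI)
  also have "card ?M = card (monomials A (d - l))" by (rule card_image) (simp add: inj_on_def)
  also have "card (monomials A d) - card (monomials A (d - l)) = hyp_hf (Suc r) d l"
    using card_monomials[OF finA A(2)] hyp_hf_complement[OF l, of r] by simp
  finally show ?thesis .
qed

text \<open>The sum is already a binomial expansion, with \<open>k i = r + i\<close> from
  \<open>d + 1 - l\<close> on, so uniqueness determines its lowering.\<close>

lemma binomial_lower_hypersurface:
  assumes "1 \<le> l" "l \<le> d"
  shows "binomial_lower (hyp_hf (Suc r) d l) d = hyp_hf r d l"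
proof -
  have e: "Suc d - l = d - l + 1" using assms by simp
  have ex: "binomial_expansion (hyp_hf (Suc r) d l) d (Suc d - l) (\<lambda>i. r + i)"
    using assms unfolding binomial_expansion_def hyp_hf_def by (intro conjI) auto
  show ?thesis
    unfolding binomial_lower_def
  proof (rule the_equality)
    show "\<exists>\<delta> k. binomial_expansion (hyp_hf (Suc r) d l) d \<delta> k \<and> hyp_hf r d l = (\<Sum>i=\<delta>..d. (k i - 1) choose i)"
      using ex by (intro exI[of _ "Suc d - l"] exI[of _ "\<lambda>i. r + i"]) (simp add: hyp_hf_def)
  next
    fix v assume "\<exists>\<delta> k. binomial_expansion (hyp_hf (Suc r) d l) d \<delta> k \<and> v = (\<Sum>i=\<delta>..d. (k i - 1) choose i)"
    then obtain \<delta> k where k: "binomial_expansion (hyp_hf (Suc r) d l) d \<delta> k"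
        "v = (\<Sum>i=\<delta>..d. (k i - 1) choose i)" by blast
    have "Suc d - l = \<delta>" "\<forall>i\<in>{Suc d - l..d}. r + i = k i"
      using binomial_expansion_unique[OF ex k(1)] by auto
    then show "v = hyp_hf r d l" unfolding k(2) hyp_hf_def by (intro sum.cong) auto
  qed
qed

text \<open>The coefficients at the variables form an identity matrix: everything spanned by the
  tail has coefficient \<open>0\<close> at the head's variable, where the head has
  \<open>1\<close>.\<close>

lemma independent_reduced:
  fixes g :: "nat \<Rightarrow> 'k::field mpoly"
  assumes "distinct xs"
    and car: "\<And>i. i \<in> set xs \<Longrightarrow> g i \<in> carrier (coord_ring n)"
    and diag: "\<And>i j. i \<in> set xs \<Longrightarrow> j \<in> set xs \<Longrightarrow>
      Poly_Mapping.lookup (g i) (xm j) = (if i = j then 1 else 0)"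
  shows "ring.independent (coord_ring n) (range Const) (map g xs)"
  using assms
proof (induction xs)
  case Nil
  interpret ring "coord_ring n :: 'k mpoly ring" by (rule ring_coord_ring)
  show ?case by simp
next
  case (Cons x xs)
  interpret ring "coord_ring n :: 'k mpoly ring" by (rule ring_coord_ring)
  have off: "Poly_Mapping.lookup (g y) (xm x) = 0" if "y \<in> set xs" for y
    using Cons.prems(3)[of y x] that Cons.prems(1) by auto
  have span: "Poly_Mapping.lookup p (xm x) = 0"
    if "p \<in> Span (range Const) (map g ys)" "set ys \<subseteq> set xs" for p ys
    using that
  proof (induction ys arbitrary: p)
    case (Cons y ys)
    then obtain a v where av: "v \<in> Span (range Const) (map g ys)" "p = Const a * g y + v"
      by (auto simp: line_extension_mem_iff)
    moreover have "Poly_Mapping.lookup (g y) (xm x) = 0" using off Cons.prems(2) by simp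
    ultimately show ?case using Cons.IH[OF av(1)] Cons.prems(2) by (simp add: lookup_add)
  qed simp
  show ?case
    unfolding list.map
  proof (rule li_Cons)
    show "g x \<in> carrier (coord_ring n)" using Cons.prems by simp
    have "Poly_Mapping.lookup (g x) (xm x) = 1" using Cons.prems(3)[of x x] by simp
    then show "g x \<notin> Span (range Const) (map g xs)" using span[of "g x" xs] by auto
    show "independent (range Const) (map g xs)" using Cons by simp
  qed
qed

theorem theorem3p10:
  fixes I :: "'k::{alg_closed_field, field_char_0} mpoly set"
    and n d l r :: nat
  assumes "subscheme_ideal n I"
    and "1 \<le> l" and "l \<le> d" and "1 \<le> r" and "r + 1 \<le> n"
    and "hilbert_function n I d = (\<Sum>j=d-l+1..d. (r + j) choose j)"
    and "hilbert_diff n I d = int (binomial_lower (hilbert_function n I d) d)"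
  shows "(\<exists>J H. linear_subspace_ideal n (r + 1) J \<and> hypersurface_ideal n J l H \<and>
            component n I d = component n H d) \<and>
         (\<exists>Ls F. length Ls = n - (r + 1) \<and> set Ls \<subseteq> forms n 1 \<and> F \<in> forms n l \<and>
            component n I d = component n (genideal (coord_ring n) (insert F (set Ls))) d)"
proof -
  let ?R = "coord_ring n :: 'k mpoly ring"
  interpret cring ?R by (rule coord_ring_cring)
  obtain S where S: "S \<subseteq> (\<Union>d. forms n d)" "I = genideal ?R S"
    using assms(1) by (auto simp: subscheme_ideal_def homogeneous_ideal_def)
  have "S \<subseteq> carrier ?R" using S(1) forms_subset_carrier by blast
  then have I: "ideal I ?R" unfolding S(2) by (rule genideal_ideal)
  have sat: "f \<in> I" if f: "f \<in> carrier ?R" "\<And>i. i \<le> n \<Longrightarrow> var_poly i * f \<in> I" for f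
  proof -
    have "\<exists>N. var_poly i ^ N * f \<in> I" if "i \<le> n" for i
      using f(2)[OF that] by (intro exI[of _ 1]) simp
    then show ?thesis using assms(1) f(1) unfolding subscheme_ideal_def saturated_def by blast
  qed
  \<comment> \<open>The hyperplane section is compared with \<open>hyp_hf r\<close>, and the growth
    bound is stated for a successor; this is where \<open>1 \<le> r\<close> enters.\<close>
  obtain r' where r': "r = Suc r'" using assms(4) by (cases r) auto
  obtain e where e: "d = Suc e" using assms(2,3) by (cases d) auto
  have "Suc d - l = d - l + 1" using assms(3) by simp
  then have Hd: "hilbert_function n I d = hyp_hf (Suc r) d l" using assms(6) by (simp add: hyp_hf_def)
  have "1 \<notin> I"
  proof
    assume "1 \<in> I"
    then have "hyp_hf (Suc r) d l = 0" using hilbert_function_unit[OF I] Hd by simp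
    moreover have "((Suc r + d - 1) choose d) \<le> hyp_hf (Suc r) d l"
      unfolding hyp_hf_def using assms(2,3) by (intro member_le_sum) auto
    moreover have "0 < ((Suc r + d - 1) choose d)" by simp
    ultimately show False by linarith
  qed
  note H = hilbert_function_eq[OF I this]
  have top: "hcount n (component n I d) d = hyp_hf (Suc r) d l" using H Hd by metis
  have "int (hcount n (component n I d) d) - int (hcount n (component n I e) e) = int (hyp_hf r d l)"
  proof -
    have "hilbert_diff n I d = int (hyp_hf r d l)"
      using assms(7) unfolding Hd binomial_lower_hypersurface[OF assms(2,3)] .
    then show ?thesis unfolding hilbert_diff_def H by (simp add: e)
  qed
  then have diff: "hyp_hf r d l + hcount n (component n I e) e \<le> hcount n (component n I d) d" by simp
  have low: "hcount n (component n I s) s \<le> hyp_hf (Suc r) s l" if "s \<le> d" for s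
    using hcount_le[OF I sat assms(2), of e r' s] top diff that unfolding e r' by simp

  let ?N = "std (component n I 1) (monomials {..n} 1)"
  \<comment> \<open>In degree one the bound is \<open>r + 1\<close> for \<open>l = 1\<close> and
    \<open>r + 2\<close> otherwise; \<open>max l 2\<close> covers both cases with the larger
    value.\<close>
  have "hyp_hf (Suc r) 1 l \<le> hyp_hf (Suc r) 1 (max l 2)" by (rule hyp_hf_mono) simp
  also have "\<dots> = Suc (Suc r)"
    using hyp_hf_truncate[of 1 "max l 2" "Suc r"] hyp_hf_full[of r 1] by simp
  finally have N: "card ?N \<le> Suc (Suc r)" using low[of 1] e by simp
  have mono1: "\<exists>i\<le>n. m = xm i" if "m \<in> monomials {..n} 1" for m
  proof -
    have m: "Poly_Mapping.keys m \<subseteq> {..n}" "mono_degree m = 1" using that by (auto simp: monomials_def)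
    then have "Poly_Mapping.keys m \<noteq> {}" by (auto simp: mono_degree_def)
    then obtain i where i: "i \<in> Poly_Mapping.keys m" by blast
    then obtain u where u: "m = u + xm i" by (auto simp: in_keys_iff intro: split_xm)
    then have "mono_degree u = 0" using m(2) by (simp add: mono_degree_add mono_degree_single)
    then show ?thesis using u i m(1) by (auto simp: mono_degree_eq_0_iff)
  qed
  define A0 where "A0 = {i. xm i \<in> ?N}"
  have xm_n: "i \<le> n" if "xm i \<in> ?N" for i using that by (simp add: std_def monomials_def)
  have NA0: "?N \<subseteq> xm ` A0" using mono1 by (auto simp: A0_def std_def)
  have "inj_on xm A0" by (auto simp: inj_on_def dest: arg_cong[of _ _ Poly_Mapping.keys])
  then have "card A0 = card (xm ` A0)" by (simp add: card_image)
  also have "xm ` A0 = ?N" using NA0 by (auto simp: A0_def)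
  finally have "card A0 \<le> Suc (Suc r)" using N by simp
  moreover have "A0 \<subseteq> {..n}" using xm_n by (auto simp: A0_def)
  \<comment> \<open>There may be fewer than \<open>r + 2\<close> standard variables, for instance
    when \<open>l = 1\<close>. Others are added so that exactly \<open>n - (r + 1)\<close> remain
    outside \<open>A\<close>.\<close>
  ultimately obtain A where A: "A0 \<subseteq> A" "A \<subseteq> {..n}" "card A = Suc (Suc r)"
    using exists_subset_between[of A0 "Suc (Suc r)" "{..n}"] assms(5) by auto
  have finA: "finite A" using A(2) finite_subset by blast
  define T where "T = {..n} - A"
  have finT: "finite T" by (simp add: T_def)
  have cardT: "card T = n - (r + 1)" using A finA by (simp add: T_def card_Diff_subset)

  have "\<exists>g. Poly_Mapping.keys g \<subseteq> ?N \<inter> {..xm i} \<and> mon (xm i) - g \<in> component n I 1" if "i \<in> T" for i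
    by (rule normal_form_mon[OF subspace_component[OF I] component_subset finite_monomials])
      (use that in \<open>auto simp: T_def monomials_def mono_degree_single\<close>)
  then obtain g where g: "\<And>i. i \<in> T \<Longrightarrow> Poly_Mapping.keys (g i) \<subseteq> ?N \<inter> {..xm i}"
    "\<And>i. i \<in> T \<Longrightarrow> mon (xm i) - g i \<in> component n I 1" by metis
  \<comment> \<open>A variable outside \<open>A\<close> minus its normal form, which involves only
    variables of \<open>A\<close>.\<close>
  define ell where "ell i = mon (xm i) - g i" for i
  have gA: "Poly_Mapping.keys (g i) \<subseteq> xm ` A" if "i \<in> T" for i
    using g(1)[OF that] NA0 A(1) by blast
  have xm_T: "xm i \<notin> xm ` A" if "i \<in> T" for i
    using that by (auto simp: T_def dest: arg_cong[of _ _ Poly_Mapping.keys])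
  have ellI: "ell i \<in> I" "ell i \<in> forms n 1" if "i \<in> T" for i
    using g(2)[OF that] by (auto simp: ell_def component_def)
  have diag: "Poly_Mapping.lookup (ell i) (xm j) = (if i = j then 1 else 0)"
    if "i \<in> T" "j \<in> T" for i j
  proof -
    have "Poly_Mapping.lookup (g i) (xm j) = 0"
      using gA[OF that(1)] xm_T[OF that(2)] by (auto simp: in_keys_iff)
    then show ?thesis by (auto simp: ell_def lookup_minus lookup_single when_def
        dest: arg_cong[of _ _ Poly_Mapping.keys])
  qed
  have ell0: "ell i \<noteq> 0" if "i \<in> T" for i using diag[OF that that] by auto
  have lead_ell: "lead (ell i) = xm i" if "i \<in> T" for i
  proof (rule antisym)
    show "xm i \<le> lead (ell i)"
      using diag[OF that that] by (intro lead_ge) (simp add: in_keys_iff)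
    have "lead (ell i) \<in> Poly_Mapping.keys (ell i)" by (rule lead_in_keys[OF ell0[OF that]])
    then have "lead (ell i) \<in> insert (xm i) (Poly_Mapping.keys (g i))"
      unfolding ell_def by (auto simp: in_keys_iff lookup_minus lookup_single when_def split: if_splits)
    then show "lead (ell i) \<le> xm i" using g(1)[OF that] by auto
  qed

  \<comment> \<open>Otherwise all monomials of degree \<open>l\<close> in the \<open>r + 2\<close>
    variables of \<open>A\<close> would be independent modulo \<open>I\<close>, one more than
    \<open>hyp_hf (Suc r) l l\<close> allows.\<close>
  have "\<exists>F\<in>I. F \<noteq> 0 \<and> Poly_Mapping.keys F \<subseteq> monomials A l"
  proof (rule ccontr)
    assume no: "\<not> ?thesis"
    have fin: "finite (monomials A l)" by (rule finite_monomials[OF finA])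
    have sub: "monomials A l \<subseteq> monomials {..n} l" using A(2) by (auto simp: monomials_def)
    have "indep_mod (component n I l) mon (monomials A l)"
      unfolding indep_mod_def
    proof (intro allI impI)
      fix a assume "(\<Sum>m\<in>monomials A l. Const (a m) * mon m) \<in> component n I l" (is "?p \<in> _")
      then have "?p \<in> I" by (simp add: component_def)
      then have p0: "?p = 0" using no keys_sum_mon[OF fin, of a] by blast
      show "\<forall>m\<in>monomials A l. a m = 0"
        using lookup_sum_mon[OF fin, of a] unfolding p0 by (metis lookup_zero)
    qed
    then have "card (monomials A l) \<le> hcount n (component n I l) l"
      using sub by (intro card_indep_mod_le[OF subspace_component[OF I] fin _ _ finite_std
            component_span_mod[OF I]]) (auto intro: mon_form)
    also have "\<dots> \<le> hyp_hf (Suc r) l l" using low assms(3) by simp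
    finally show False
      using card_monomials[OF finA A(3), of l] hyp_hf_full[of r l] hyp_hf_Suc[of "Suc r" l] by simp
  qed
  then obtain F where F: "F \<in> I" "F \<noteq> 0" "Poly_Mapping.keys F \<subseteq> monomials A l" by blast
  have "monomials A l \<subseteq> monomials {..n} l" using A(2) by (auto simp: monomials_def)
  then have Ff: "F \<in> forms n l" using F(3) by (auto simp: forms_eq poly_span_def)
  have Fc: "F \<in> carrier ?R" using Ff forms_subset_carrier by blast

  define Ls where "Ls = map ell (sorted_list_of_set T)"
  have setLs: "set Ls = ell ` T" and lenLs: "length Ls = n - (r + 1)"
    using finT cardT by (simp_all add: Ls_def)
  have Lsf: "set Ls \<subseteq> forms n 1" using ellI(2) setLs by auto
  have Lsc: "set Ls \<subseteq> carrier ?R" using Lsf forms_subset_carrier by blast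
  have LsI: "set Ls \<subseteq> I" using ellI(1) setLs by auto
  define J where "J = genideal ?R (set Ls)"
  have J: "ideal J ?R" unfolding J_def by (rule genideal_ideal[OF Lsc])
  have LsJ: "set Ls \<subseteq> J" unfolding J_def by (rule genideal_self[OF Lsc])
  have JI: "J \<subseteq> I" unfolding J_def by (rule genideal_minimal[OF I LsI])

  \<comment> \<open>The leads of the linear forms and of \<open>F\<close> bound the standard
    monomials of \<open>K\<close> by the number that \<open>I\<close> attains in degree
    \<open>d\<close>; with \<open>K \<subseteq> I\<close> this forces equality. Both descriptions in
    the conclusion are instances.\<close>
  have agree: "component n I d = component n K d"
    if K: "ideal K ?R" "K \<subseteq> I" "set Ls \<subseteq> K" "F \<in> K" for K
  proof -
    have "hcount n (component n K d) d \<le> hyp_hf (Suc r) d l"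
    proof (rule hcount_hypersurface_le[OF K(1) A(2,3) assms(3) _ K(4) F(2,3)])
      fix i assume "i \<in> {..n} - A"
      then have "i \<in> T" by (simp add: T_def)
      then show "\<exists>f. f \<in> K \<and> f \<in> forms n 1 \<and> f \<noteq> 0 \<and> lead f = xm i"
        using ellI(2) ell0 lead_ell K(3) setLs by blast
    qed
    then have "component n K d = component n I d"
      using K(2) top
      by (intro subspace_eq_of_card_std[OF subspace_component[OF K(1)] _ subspace_component[OF I]
            component_subset finite_monomials]) (auto simp: component_def)
    then show ?thesis ..
  qed

  have "linear_subspace_ideal n (r + 1) J"
    unfolding linear_subspace_ideal_def
  proof (intro conjI exI)
    show "ring.independent ?R (range Const) Ls"
      unfolding Ls_def
      by (rule independent_reduced) (use diag subsetD[OF Lsc] setLs finT in auto)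
  qed (use assms(5) lenLs Lsf J_def in auto)
  moreover have "F \<notin> J"
  proof
    assume FJ: "F \<in> J"
    \<comment> \<open>Solves the equations \<open>ell i = 0\<close> for the variables outside
      \<open>A\<close>: the substitution kills \<open>J\<close> but fixes \<open>F\<close>, which
      involves only variables of \<open>A\<close>.\<close>
    define \<phi> where "\<phi> i = (if i \<in> T then g i else var_poly i)" for i
    have "subst \<phi> (ell i) = 0" if "i \<in> T" for i
    proof -
      have "subst \<phi> (ell i) = subst \<phi> (mon (xm i)) + subst \<phi> (- g i)"
        unfolding ell_def subst_add[symmetric] by simp
      moreover have "subst \<phi> (mon (xm i)) = g i"
        using that by (simp add: subst_single subst_mon_def \<phi>_def)
      moreover have "subst \<phi> (g i) = g i"
        by (rule subst_id) (use gA[OF that] in \<open>fastforce simp: \<phi>_def T_def\<close>)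
      ultimately show ?thesis by (simp add: subst_uminus)
    qed
    then have "subst \<phi> F = 0"
      by (intro subst_genideal[OF Lsc _ FJ[unfolded J_def]]) (auto simp: setLs)
    moreover have "subst \<phi> F = F"
      by (rule subst_id) (use F(3) in \<open>auto simp: \<phi>_def T_def monomials_def\<close>)
    ultimately show False using F(2) by simp
  qed
  then have "hypersurface_ideal n J l (J <+>\<^bsub>?R\<^esub> PIdl\<^bsub>?R\<^esub> F)"
    unfolding hypersurface_ideal_def using Ff by blast
  moreover have "component n I d = component n (J <+>\<^bsub>?R\<^esub> PIdl\<^bsub>?R\<^esub> F) d"
  proof (rule agree)
    have P: "ideal (PIdl\<^bsub>?R\<^esub> F) ?R" by (rule cgenideal_ideal[OF Fc])
    have PI: "PIdl\<^bsub>?R\<^esub> F \<subseteq> I" by (rule cgenideal_minimal[OF I F(1)])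
    have FP: "F \<in> PIdl\<^bsub>?R\<^esub> F" by (rule cgenideal_self[OF Fc])
    show "ideal (J <+>\<^bsub>?R\<^esub> PIdl\<^bsub>?R\<^esub> F) ?R" by (rule add_ideals[OF J P])
    have mem: "x \<in> J <+>\<^bsub>?R\<^esub> PIdl\<^bsub>?R\<^esub> F \<longleftrightarrow> (\<exists>a\<in>J. \<exists>b\<in>PIdl\<^bsub>?R\<^esub> F. x = a + b)" for x
      by (auto simp: set_add_def')
    show "J <+>\<^bsub>?R\<^esub> PIdl\<^bsub>?R\<^esub> F \<subseteq> I"
      using mp.subspace_add[OF subspace_ideal[OF I] subsetD[OF JI] subsetD[OF PI]] by (auto simp: mem)
    show "set Ls \<subseteq> J <+>\<^bsub>?R\<^esub> PIdl\<^bsub>?R\<^esub> F"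
      using LsJ mp.subspace_0[OF subspace_ideal[OF P]] by (force simp: mem)
    show "F \<in> J <+>\<^bsub>?R\<^esub> PIdl\<^bsub>?R\<^esub> F"
      using FP mp.subspace_0[OF subspace_ideal[OF J]] by (force simp: mem)
  qed
  moreover have "component n I d = component n (genideal ?R (insert F (set Ls))) d"
  proof (rule agree)
    have c: "insert F (set Ls) \<subseteq> carrier ?R" using Fc Lsc by simp
    show "ideal (genideal ?R (insert F (set Ls))) ?R" by (rule genideal_ideal[OF c])
    show "genideal ?R (insert F (set Ls)) \<subseteq> I"
      by (rule genideal_minimal[OF I]) (use F(1) LsI in simp)
    show "set Ls \<subseteq> genideal ?R (insert F (set Ls))" "F \<in> genideal ?R (insert F (set Ls))"
      using genideal_self[OF c] by simp_all
  qed
  ultimately show ?thesis using lenLs Lsf Ff by blast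
qed

end
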